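(* For every $\epsilon > 0$ there exists $c > 0$ such that for every finite set $A \subset \mathbb{R}$, \[ \max\left\{ |A+A|,\ |AA| \right\} \geq c\,|A|^{\frac{4}{3} + \frac{10}{4407} - \epsilon}. \]
   Context: For finite $A \subset \mathbb{R}$, $A+A = \{a_1+a_2 : a_1,a_2 \in A\}$ and $AA = \{a_1 a_2 : a_1,a_2\in A\}$. *)

theory Defs
  imports Complex_Main
begin

definition sumset :: "real set \<Rightarrow> real set" where
  "sumset A = {a1 + a2 | a1 a2. a1 \<in> A \<and> a2 \<in> A}"

definition prodset :: "real set \<Rightarrow> real set" where
  "prodset A = {a1 * a2 | a1 a2. a1 \<in> A \<and> a2 \<in> A}"

end

theory Submission
  imports Defs "HOL-Analysis.Harmonic_Numbers" "HOL-Library.Discrete_Functions" "HOL-Real_Asymp.Real_Asymp"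
begin

text \<open>The slopes \<open>\<lambda>\<close> of the lines through the origin carrying about \<open>\<tau>\<close> points of \<open>A \<times> A\<close> account for the
  multiplicative energy, which is at least \<open>|A|\<^sup>4 / |AA|\<close>. Following Solymosi, Konyagin and Shkredov, if
  \<open>|A + A|\<close> is only slightly larger than \<open>|A|\<^bsup>4/3\<^esup>\<close>, then sums of points on nearby lines must coincide often,
  and some four slopes \<open>\<lambda>\<^sub>1, \<dots>, \<lambda>\<^sub>4\<close> yield many solutions of the linear equation
  \<open>(\<lambda>\<^sub>1 - \<lambda>\<^sub>4) p\<^sub>1 + (\<lambda>\<^sub>2 - \<lambda>\<^sub>4) p\<^sub>2 = (\<lambda>\<^sub>3 - \<lambda>\<^sub>4) p\<^sub>3\<close> with \<open>p\<^sub>i \<in> A \<inter> \<lambda>\<^sub>i\<^sup>-\<^sup>1 A\<close>. The additive structure of these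
  sets forces their multiplicative energy to be small (Elekes and Ruzsa), so dilating the solutions by the
  elements of \<open>A\<close> produces almost \<open>|A|\<close> times as many solutions inside \<open>AA\<close>. But a typical product \<open>a p\<close> has many
  representations \<open>x / \<mu>\<close> with \<open>x \<in> AA\<close> and \<open>\<mu>\<close> a popular slope, and then the Szemeredi--Trotter bound for
  Cartesian products rules out so many solutions. Quantitatively this gives, up to logarithms,
  \<open>|A|\<^bsup>159\<^esup> \<le> max(|A + A|, |AA|)\<^bsup>119\<^esup>\<close>, and \<open>159/119 = 4/3 + 1/357 > 4/3 + 10/4407\<close>.\<close>

subsection \<open>Fibres and collisions\<close>

lemma card_eq_sum_card_fibres:
  assumes "finite X" "finite Y" "f ` X \<subseteq> Y"
  shows "card X = (\<Sum>y\<in>Y. card {x\<in>X. f x = y})"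
  using sum_fun_comp[OF assms, of "\<lambda>_. 1 :: nat"] by simp

lemma card_le_mult_fibres:
  fixes c :: real
  assumes "finite X" "finite Y" "f ` X \<subseteq> Y" "\<And>y. y \<in> Y \<Longrightarrow> card {x\<in>X. f x = y} \<le> c"
  shows "card X \<le> c * card Y"
proof -
  have "real (card X) = (\<Sum>y\<in>Y. real (card {x\<in>X. f x = y}))"
    using card_eq_sum_card_fibres[OF assms(1-3)] by simp
  also have "\<dots> \<le> card Y * c" by (rule sum_bounded_above) (rule assms(4))
  finally show ?thesis by (simp add: mult.commute)
qed

lemma mult_card_image_le_card:
  fixes c :: real
  assumes "finite X" "\<And>x. x \<in> X \<Longrightarrow> c \<le> card {x'\<in>X. f x' = f x}"
  shows "c * card (f ` X) \<le> card X"
proof -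
  have "card (f ` X) * c \<le> (\<Sum>y\<in>f ` X. real (card {x\<in>X. f x = y}))"
    by (rule sum_bounded_below) (use assms(2) in auto)
  also have "\<dots> = card X" using card_eq_sum_card_fibres[of X "f ` X" f] assms(1) by simp
  finally show ?thesis by (simp add: mult.commute)
qed

lemma card_light_fibres_le:
  fixes c :: real
  assumes "finite X" "finite Y" "f ` X \<subseteq> Y" "0 \<le> c"
  shows "card {x\<in>X. card {x'\<in>X. f x' = f x} < c} \<le> c * card Y"
proof (rule card_le_mult_fibres[where f = f])
  let ?light = "{x\<in>X. card {x'\<in>X. f x' = f x} < c}"
  fix y
  show "card {x\<in>?light. f x = y} \<le> c"
  proof (cases "{x\<in>?light. f x = y} = {}")
    case True
    then show ?thesis using assms(4) by (simp only: card.empty of_nat_0)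
  next
    case False
    then obtain x where light: "card {x'\<in>X. f x' = f x} < c" "f x = y" by blast
    have "card {x\<in>?light. f x = y} \<le> card {x'\<in>X. f x' = f x}"
      by (rule card_mono) (use assms(1) light(2) in auto)
    then show ?thesis using light(1) by linarith
  qed
qed (use assms in auto)

lemma card_light_fibres_le_quarter:
  fixes t :: real
  assumes "finite X" "finite Y" "f ` X \<subseteq> Y" "card Y \<le> t" "t > 0"
  shows "card {x\<in>X. card {x'\<in>X. f x' = f x} < card X / (4 * t)} \<le> card X / 4"
proof -
  have "card {x\<in>X. card {x'\<in>X. f x' = f x} < card X / (4 * t)} \<le> card X / (4 * t) * card Y"
    by (rule card_light_fibres_le) (use assms in auto)
  also have "\<dots> \<le> card X / (4 * t) * t"
    by (rule mult_left_mono) (use assms in auto)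
  finally show ?thesis using assms(5) by simp
qed

lemma exists_subset_with_rich_fibres:
  fixes t :: real
  assumes "finite W" "t > 0" "finite X" "f ` W \<subseteq> X" "card X \<le> t" "finite Y" "g ` W \<subseteq> Y" "card Y \<le> t"
  obtains V where "V \<subseteq> W" "card W / 2 \<le> card V"
    "\<And>v. v \<in> V \<Longrightarrow> card W / (4 * t) \<le> card {w\<in>W. f w = f v}"
    "\<And>v. v \<in> V \<Longrightarrow> card W / (4 * t) \<le> card {w\<in>W. g w = g v}"
proof -
  define F where "F = {w\<in>W. card {w'\<in>W. f w' = f w} < card W / (4 * t)}"
  define G where "G = {w\<in>W. card {w'\<in>W. g w' = g w} < card W / (4 * t)}"
  have "card F \<le> card W / 4" "card G \<le> card W / 4"
    unfolding F_def G_def by (rule card_light_fibres_le_quarter; use assms in simp)+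
  moreover have "card W - card (F \<union> G) \<le> card (W - (F \<union> G))"
    using assms(1) by (intro diff_card_le_card_Diff) (auto simp: F_def G_def)
  moreover have "card (F \<union> G) \<le> card F + card G" by (rule card_Un_le)
  ultimately have "card W / 2 \<le> card (W - (F \<union> G))" by linarith
  then show thesis by (rule that[rotated]) (auto simp: F_def G_def)
qed

lemma sum_le_threshold:
  fixes f :: "'a \<Rightarrow> real" and r :: real
  assumes "finite X" "0 \<le> r"
  shows "sum f X \<le> r * card X + (\<Sum>x\<in>{x\<in>X. r \<le> f x}. f x)"
proof -
  have "sum f X \<le> (\<Sum>x\<in>X. r + (if r \<le> f x then f x else 0))"
    by (rule sum_mono) (use assms in auto)
  also have "\<dots> = r * card X + (\<Sum>x\<in>{x\<in>X. r \<le> f x}. f x)"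
    using assms by (simp add: sum.distrib sum.inter_filter)
  finally show ?thesis .
qed

lemma exists_ge_average:
  fixes f :: "'a \<Rightarrow> real" and c :: real
  assumes "finite X" "X \<noteq> {}" "card X * c \<le> sum f X"
  obtains x where "x \<in> X" "c \<le> f x"
proof -
  have "\<not> (\<forall>x\<in>X. f x < c)"
    using sum_bounded_above_strict[of X f c] assms by (auto simp: card_gt_0_iff)
  then show thesis using that by (auto simp: not_less)
qed

definition collisions :: "('a \<Rightarrow> 'b) \<Rightarrow> 'a set \<Rightarrow> ('a \<times> 'a) set" where
  "collisions f X = {(x, x'). x \<in> X \<and> x' \<in> X \<and> f x = f x'}"

lemma collisions_subset: "collisions f X \<subseteq> X \<times> X"
  by (auto simp: collisions_def)

lemma finite_collisions [simp]: "finite X \<Longrightarrow> finite (collisions f X)"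
  by (rule finite_subset[OF collisions_subset]) simp

lemma card_collisions_eq_sum_card_fibres:
  assumes "finite X"
  shows "card (collisions f X) = (\<Sum>x\<in>X. card {x'\<in>X. f x' = f x})"
proof -
  have "collisions f X = (SIGMA x:X. {x'\<in>X. f x' = f x})" by (auto simp: collisions_def)
  then show ?thesis using assms by simp
qed

lemma card_collisions_eq_sum_squares:
  assumes "finite X" "finite Y" "f ` X \<subseteq> Y"
  shows "card (collisions f X) = (\<Sum>y\<in>Y. (card {x\<in>X. f x = y})\<^sup>2)"
  unfolding card_collisions_eq_sum_card_fibres[OF assms(1)]
  using sum_fun_comp[OF assms, of "\<lambda>y. card {x\<in>X. f x = y}"] by (simp add: power2_eq_square)

lemma card_collisions_le:
  fixes c :: real
  assumes "finite X" "\<And>x. x \<in> X \<Longrightarrow> card {x'\<in>X. f x' = f x} \<le> c"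
  shows "card (collisions f X) \<le> c * card X"
  unfolding card_collisions_eq_sum_card_fibres[OF assms(1)]
  using sum_bounded_above[of X "\<lambda>x. real (card {x'\<in>X. f x' = f x})" c] assms(2)
  by (simp add: mult.commute)

lemma card_squared_le_card_collisions:
  assumes "finite X" "finite Y" "f ` X \<subseteq> Y"
  shows "(card X)\<^sup>2 \<le> card Y * card (collisions f X)"
proof -
  have "(\<Sum>y\<in>Y. real (card {x\<in>X. f x = y}))\<^sup>2 \<le> (\<Sum>y\<in>Y. (real (card {x\<in>X. f x = y}))\<^sup>2) * card Y"
    using sum_squared_le_sum_of_squares[of "\<lambda>y. real (card {x\<in>X. f x = y})" Y] assms(2) by (cases "Y = {}") auto
  also have "\<dots> = real (card Y * card (collisions f X))"
    using card_collisions_eq_sum_squares[OF assms] by simp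
  finally have "real ((card X)\<^sup>2) \<le> real (card Y * card (collisions f X))"
    using card_eq_sum_card_fibres[OF assms] by simp
  then show ?thesis by (simp only: of_nat_le_iff)
qed

lemma card_collisions_eq_add_Diff_Id:
  assumes "finite X"
  shows "card (collisions f X) = card X + card (collisions f X - Id)"
proof -
  have "collisions f X = (\<lambda>x. (x, x)) ` X \<union> (collisions f X - Id)" by (auto simp: collisions_def)
  also have "card \<dots> = card ((\<lambda>x. (x, x)) ` X) + card (collisions f X - Id)"
    by (rule card_Un_disjoint) (use assms in auto)
  finally show ?thesis by (simp add: card_image inj_on_def)
qed

subsection \<open>Incidences in Cartesian products\<close>

definition block_index :: "'a::linorder set \<Rightarrow> nat \<Rightarrow> 'a \<Rightarrow> nat" where
  "block_index X g x = card {y\<in>X. y < x} div g"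

lemma mono_block_index: "finite X \<Longrightarrow> mono (block_index X g)"
  unfolding block_index_def by (intro monoI div_le_mono card_mono) auto

lemma block_index_less:
  assumes "finite X" "x \<in> X" "card X \<le> k * g"
  shows "block_index X g x < k"
proof -
  have "card {y\<in>X. y < x} < card X"
    by (rule psubset_card_mono) (use assms in auto)
  then show ?thesis
    unfolding block_index_def using assms(3) by (intro less_mult_imp_div_less) linarith
qed

lemma strict_mono_on_card_less:
  fixes X :: "'a::linorder set"
  assumes "finite X"
  shows "strict_mono_on X (\<lambda>x. card {y\<in>X. y < x})"
  by (intro strict_mono_onI psubset_card_mono) (use assms in auto)

lemma card_block_index_fibre_le:
  assumes "finite X" "g > 0"
  shows "card {x\<in>X. block_index X g x = i} \<le> g"
proof -
  let ?rank = "\<lambda>x. card {y\<in>X. y < x}"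
  have "inj_on ?rank {x\<in>X. block_index X g x = i}"
    using strict_mono_on_imp_inj_on[OF strict_mono_on_card_less[OF assms(1)]] by (rule inj_on_subset) auto
  moreover have "?rank ` {x\<in>X. block_index X g x = i} \<subseteq> {i * g..<i * g + g}"
    using assms(2) dividend_less_div_times[of g] by (auto simp: block_index_def add.commute)
  ultimately have "card {x\<in>X. block_index X g x = i} \<le> card {i * g..<i * g + g}"
    by (rule card_inj_on_le) auto
  then show ?thesis by simp
qed

lemma card_collisions_block_index_le:
  assumes "finite X" "0 < k" "k \<le> card X"
  shows "card (collisions (block_index X (card X div k + 1)) X) \<le> 2 * (real (card X))\<^sup>2 / k"
proof -
  have "card (collisions (block_index X (card X div k + 1)) X) \<le> real (card X div k + 1) * card X"
    by (intro card_collisions_le of_nat_mono card_block_index_fibre_le) (use assms in auto)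
  also have "\<dots> \<le> 2 * card X / k * card X"
  proof (rule mult_right_mono)
    have "real (card X div k) \<le> card X / k" by (rule of_nat_div_le_of_nat)
    moreover have "1 \<le> card X / k" using assms by simp
    ultimately show "real (card X div k + 1) \<le> 2 * card X / k" by simp
  qed simp
  finally show ?thesis by (simp add: power2_eq_square)
qed

text \<open>A monotone staircase through a \<open>k \<times> k\<close> array of cells meets fewer than \<open>2 k\<close> of them:
  the sum of the two cell indices determines the cell.\<close>

lemma card_squared_le_mono_collisions:
  fixes f g :: "'a::linorder \<Rightarrow> nat"
  assumes "finite X" "mono_on X f" "mono_on X g" "f ` X \<subseteq> {..<k}" "g ` X \<subseteq> {..<k}"
  shows "(card X)\<^sup>2 \<le> 2 * k * card (collisions (\<lambda>x. (f x, g x)) X)"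
proof -
  have "f x = f y \<and> g x = g y" if "x \<in> X" "y \<in> X" "f x + g x = f y + g y" for x y
  proof (cases "x \<le> y")
    case True
    then have "f x \<le> f y" "g x \<le> g y" using that assms(2,3) by (auto dest: mono_onD)
    then show ?thesis using that(3) by linarith
  next
    case False
    then have "f y \<le> f x" "g y \<le> g x" using that assms(2,3) by (auto dest: mono_onD)
    then show ?thesis using that(3) by linarith
  qed
  then have "collisions (\<lambda>x. f x + g x) X \<subseteq> collisions (\<lambda>x. (f x, g x)) X"
    by (auto simp: collisions_def)
  then have "card (collisions (\<lambda>x. f x + g x) X) \<le> card (collisions (\<lambda>x. (f x, g x)) X)"
    by (rule card_mono[rotated]) (use assms(1) in simp)
  moreover have "(card X)\<^sup>2 \<le> card {..<2 * k} * card (collisions (\<lambda>x. f x + g x) X)"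
    by (rule card_squared_le_card_collisions) (use assms in fastforce)+
  ultimately show ?thesis by (simp add: order_trans[OF _ mult_le_mono2])
qed

lemma card_squared_le_antimono_collisions:
  fixes f g :: "'a::linorder \<Rightarrow> nat"
  assumes "finite X" "mono_on X f" "antimono_on X g" "f ` X \<subseteq> {..<k}" "g ` X \<subseteq> {..<k}"
  shows "(card X)\<^sup>2 \<le> 2 * k * card (collisions (\<lambda>x. (f x, g x)) X)"
proof -
  have "mono_on X (\<lambda>x. k - 1 - g x)"
    using assms(3) by (intro monotone_onI diff_le_mono2) (rule monotone_onD)
  then have "(card X)\<^sup>2 \<le> 2 * k * card (collisions (\<lambda>x. (f x, k - 1 - g x)) X)"
    by (rule card_squared_le_mono_collisions[OF assms(1,2)]) (use assms in auto)
  also have "collisions (\<lambda>x. (f x, k - 1 - g x)) X = collisions (\<lambda>x. (f x, g x)) X"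
  proof -
    have "k - 1 - g x = k - 1 - g x' \<longleftrightarrow> g x = g x'" if "x \<in> X" "x' \<in> X" for x x'
    proof -
      have "g x < k" "g x' < k" using that assms(5) by auto
      then show ?thesis by arith
    qed
    then show ?thesis by (auto simp: collisions_def)
  qed
  finally show ?thesis .
qed

text \<open>The pair \<open>(m, b)\<close> stands for the line \<open>y = m x + b\<close>, and its points in \<open>X \<times> Y\<close> are
  recorded by their abscissae.\<close>

definition line_at :: "'a::linordered_field \<times> 'a \<Rightarrow> 'a \<Rightarrow> 'a" where
  "line_at l x = fst l * x + snd l"

definition line_points :: "'a::linordered_field set \<Rightarrow> 'a set \<Rightarrow> 'a \<times> 'a \<Rightarrow> 'a set" where
  "line_points X Y l = {x\<in>X. line_at l x \<in> Y}"

lemma finite_line_points [simp]: "finite X \<Longrightarrow> finite (line_points X Y l)"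
  by (simp add: line_points_def)

lemma card_line_points_le:
  assumes "finite X" "finite Y" "fst l \<noteq> 0"
  shows "card (line_points X Y l) \<le> card X" "card (line_points X Y l) \<le> card Y"
proof -
  show "card (line_points X Y l) \<le> card X"
    by (rule card_mono) (use assms in \<open>auto simp: line_points_def\<close>)
  show "card (line_points X Y l) \<le> card Y"
    by (rule card_inj_on_le[of "line_at l"])
       (use assms in \<open>auto simp: line_points_def line_at_def inj_on_def\<close>)
qed

lemma two_points_determine_line:
  assumes "x \<noteq> x'" "line_at l x = line_at l' x" "line_at l x' = line_at l' x'"
  shows "l = l'"
proof -
  have "(fst l - fst l') * (x - x') = 0"
    using assms(2,3) by (simp add: line_at_def algebra_simps)
  then have "fst l = fst l'" using assms(1) by simp
  then show ?thesis using assms(2) by (simp add: line_at_def prod_eq_iff)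
qed

lemma card_line_points_squared_le:
  fixes f g :: "'a::linordered_field \<Rightarrow> nat"
  assumes fin: "finite X" "finite Y" and slope: "fst l \<noteq> 0" and mono: "mono f" "mono g"
    and cells: "f ` X \<subseteq> {..<k}" "g ` Y \<subseteq> {..<k}" and rich: "4 * k \<le> card (line_points X Y l)"
  shows "(card (line_points X Y l))\<^sup>2
    \<le> 4 * k * card (collisions (\<lambda>x. (f x, g (line_at l x))) (line_points X Y l) - Id)"
proof -
  define P where "P = line_points X Y l"
  let ?coll = "collisions (\<lambda>x. (f x, g (line_at l x))) P"
  have finP: "finite P" using fin by (simp add: P_def)
  have "mono_on P f" by (rule monotone_on_subset[OF mono(1)]) simp
  moreover have "f ` P \<subseteq> {..<k}" "(\<lambda>x. g (line_at l x)) ` P \<subseteq> {..<k}"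
    using cells by (auto simp: P_def line_points_def)
  moreover have "mono_on P (\<lambda>x. g (line_at l x))" if "fst l > 0"
    using that by (intro mono_onI monoD[OF mono(2)]) (simp add: line_at_def)
  moreover have "antimono_on P (\<lambda>x. g (line_at l x))" if "fst l < 0"
    using that by (intro monotone_onI monoD[OF mono(2)]) (simp add: line_at_def mult_left_mono_neg)
  ultimately have "(card P)\<^sup>2 \<le> 2 * k * card ?coll"
    using slope card_squared_le_mono_collisions[OF finP] card_squared_le_antimono_collisions[OF finP]
    by (cases "fst l > 0") (simp_all add: not_less_iff_gr_or_eq)
  then have "(card P)\<^sup>2 \<le> 2 * k * card P + 2 * k * card (?coll - Id)"
    by (simp add: card_collisions_eq_add_Diff_Id[OF finP] distrib_left)
  moreover have "4 * k * card P \<le> (card P)\<^sup>2"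
    using rich by (simp add: P_def power2_eq_square)
  ultimately show ?thesis by (simp add: P_def)
qed

lemma sum_card_line_collisions_le:
  assumes fin: "finite X" "finite Y" "finite L"
  shows "(\<Sum>l\<in>L. card (collisions (\<lambda>x. (f x, g (line_at l x))) (line_points X Y l) - Id))
    \<le> card (collisions f X) * card (collisions g Y)"
proof -
  let ?pairs = "\<lambda>l. collisions (\<lambda>x. (f x, g (line_at l x))) (line_points X Y l) - Id"
  let ?F = "\<lambda>(l, x, x'). ((x, x'), (line_at l x, line_at l x'))"
  have "(\<Sum>l\<in>L. card (?pairs l)) = card (SIGMA l:L. ?pairs l)"
    using fin by simp
  also have "\<dots> \<le> card (collisions f X \<times> collisions g Y)"
  proof (rule card_inj_on_le[of ?F])
    show "inj_on ?F (SIGMA l:L. ?pairs l)"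
      by (rule inj_onI) (auto dest: two_points_determine_line)
    show "?F ` (SIGMA l:L. ?pairs l) \<subseteq> collisions f X \<times> collisions g Y"
      by (auto simp: collisions_def line_points_def)
  qed (use fin in simp)
  finally show ?thesis by (simp add: card_cartesian_product)
qed

lemma sum_card_line_points_squared_le:
  assumes fin: "finite X" "finite Y" "finite L" and slope: "\<And>l. l \<in> L \<Longrightarrow> fst l \<noteq> 0"
    and k_bounds: "0 < k" "k \<le> card X" "k \<le> card Y"
    and rich: "\<And>l. l \<in> L \<Longrightarrow> 4 * k \<le> card (line_points X Y l)"
  shows "(\<Sum>l\<in>L. (real (card (line_points X Y l)))\<^sup>2) \<le> 16 * (real (card X) * card Y)\<^sup>2 / k"
proof -
  define f where "f = block_index X (card X div k + 1)"
  define g where "g = block_index Y (card Y div k + 1)"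
  let ?pairs = "\<lambda>l. collisions (\<lambda>x. (f x, g (line_at l x))) (line_points X Y l) - Id"
  have "card Z \<le> k * (card Z div k + 1)" for Z :: "'a set"
    using dividend_less_times_div[OF k_bounds(1), of "card Z"] by simp
  then have cells: "f ` X \<subseteq> {..<k}" "g ` Y \<subseteq> {..<k}"
    unfolding f_def g_def using fin by (auto intro!: block_index_less)
  have "(card (line_points X Y l))\<^sup>2 \<le> 4 * k * card (?pairs l)" if "l \<in> L" for l
    by (intro card_line_points_squared_le cells slope rich that)
       (use fin in \<open>simp_all add: f_def g_def mono_block_index\<close>)
  then have "(\<Sum>l\<in>L. (card (line_points X Y l))\<^sup>2) \<le> 4 * k * (\<Sum>l\<in>L. card (?pairs l))"
    unfolding sum_distrib_left by (rule sum_mono)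
  also have "\<dots> \<le> 4 * k * (card (collisions f X) * card (collisions g Y))"
    by (intro mult_le_mono2 sum_card_line_collisions_le fin)
  finally have "real (\<Sum>l\<in>L. (card (line_points X Y l))\<^sup>2)
      \<le> real (4 * k * (card (collisions f X) * card (collisions g Y)))" by (rule of_nat_mono)
  then have "(\<Sum>l\<in>L. (real (card (line_points X Y l)))\<^sup>2)
      \<le> 4 * real k * (real (card (collisions f X)) * card (collisions g Y))" by simp
  also have "\<dots> \<le> 4 * real k * ((2 * (real (card X))\<^sup>2 / k) * (2 * (real (card Y))\<^sup>2 / k))"
    unfolding f_def g_def
    by (intro mult_left_mono mult_mono card_collisions_block_index_le) (use fin k_bounds in auto)
  also have "\<dots> = 16 * (real (card X) * card Y)\<^sup>2 / k"
    using k_bounds by (simp add: field_simps power2_eq_square)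
  finally show ?thesis .
qed

lemma sum_rich_lines_squared_le:
  fixes r :: real
  assumes fin: "finite X" "finite Y" "finite L" and slope: "\<And>l. l \<in> L \<Longrightarrow> fst l \<noteq> 0"
    and rich: "\<And>l. l \<in> L \<Longrightarrow> r \<le> card (line_points X Y l)" and r_ge_4: "4 \<le> r"
  shows "(\<Sum>l\<in>L. (real (card (line_points X Y l)))\<^sup>2) \<le> 128 * (real (card X) * card Y)\<^sup>2 / r"
proof (cases "L = {}")
  case True
  then show ?thesis using r_ge_4 by simp
next
  case False
  then obtain l where l_in_L: "l \<in> L" by auto
  define k where "k = nat \<lfloor>r / 4\<rfloor>"
  have k_bounds: "real k \<le> r / 4" "r / 4 < real k + 1" "1 \<le> k"
    using r_ge_4 unfolding k_def by linarith+
  then have "0 < k" "1 \<le> real k" by simp_all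
  with k_bounds(2) have k_ge: "r / 8 \<le> real k" by linarith
  have "k \<le> card X" "k \<le> card Y"
    using rich[OF l_in_L] card_line_points_le[OF fin(1,2) slope[OF l_in_L]] k_bounds r_ge_4 by linarith+
  moreover have "4 * k \<le> card (line_points X Y l)" if "l \<in> L" for l
    using rich[OF that] k_bounds(1) by linarith
  ultimately have "(\<Sum>l\<in>L. (real (card (line_points X Y l)))\<^sup>2) \<le> 16 * (real (card X) * card Y)\<^sup>2 / k"
    using fin slope \<open>0 < k\<close> by (intro sum_card_line_points_squared_le) auto
  also have "\<dots> \<le> 16 * (real (card X) * card Y)\<^sup>2 / (r / 8)"
    by (rule divide_left_mono) (use k_ge \<open>0 < k\<close> r_ge_4 in simp_all)
  finally show ?thesis by simp
qed

text \<open>The Szemeredi--Trotter bound for Cartesian products, in the range where its main term dominates.\<close>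

lemma incidences_cubed_le:
  fixes I :: real and L :: "('a::linordered_field \<times> 'a) set"
  assumes fin: "finite X" "finite Y" "finite L" and slope: "\<And>l. l \<in> L \<Longrightarrow> fst l \<noteq> 0"
    and incidences: "I \<le> (\<Sum>l\<in>L. real (card (line_points X Y l)))" "8 * real (card L) \<le> I"
  shows "I ^ 3 \<le> 1024 * (real (card X) * card Y * card L)\<^sup>2"
proof (cases "L = {}")
  case True
  then show ?thesis using incidences by simp
next
  case False
  let ?k = "\<lambda>l. real (card (line_points X Y l))"
  have cardL: "real (card L) > 0" using False fin by (simp add: card_gt_0_iff)
  define r where "r = I / (2 * real (card L))"
  have r_ge_4: "4 \<le> r" using incidences(2) cardL by (simp add: r_def field_simps)
  let ?rich = "{l\<in>L. r \<le> ?k l}"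
  have "I \<le> r * card L + sum ?k ?rich"
    using incidences(1) sum_le_threshold[of L r ?k] fin r_ge_4 by simp
  moreover have "r * card L = I / 2" using cardL by (simp add: r_def)
  ultimately have "r * (I / 2) \<le> r * sum ?k ?rich" using r_ge_4 by (intro mult_left_mono) auto
  also have "\<dots> \<le> (\<Sum>l\<in>?rich. (?k l)\<^sup>2)"
    unfolding sum_distrib_left by (intro sum_mono) (auto simp: power2_eq_square mult_right_mono)
  also have "\<dots> \<le> 128 * (real (card X) * card Y)\<^sup>2 / r"
    by (rule sum_rich_lines_squared_le) (use fin slope r_ge_4 in auto)
  finally have "r\<^sup>2 * I \<le> 256 * (real (card X) * card Y)\<^sup>2"
    using r_ge_4 by (simp add: field_simps power2_eq_square)
  then have "I ^ 3 / (4 * (real (card L))\<^sup>2) \<le> 256 * (real (card X) * card Y)\<^sup>2"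
    by (simp add: r_def power_divide power_mult_distrib power3_eq_cube power2_eq_square)
  then show ?thesis using cardL by (simp add: field_simps)
qed

lemma sum_mult_card_line_points_le:
  fixes K r :: real
  assumes fin: "finite X" "finite Y" "finite X'" "finite Y'" "finite L"
    and slope: "\<And>l. l \<in> L \<Longrightarrow> fst l \<noteq> 0" and r_ge_4: "4 \<le> r"
    and grid_le: "real (card X) * card Y \<le> K" "real (card X') * card Y' \<le> K"
  shows "(\<Sum>l\<in>L. real (card (line_points X Y l)) * card (line_points X' Y' l))
    \<le> r * (\<Sum>l\<in>L. card (line_points X' Y' l)) + 256 * K\<^sup>2 / r"
proof -
  let ?k = "\<lambda>l. real (card (line_points X Y l))" and ?k' = "\<lambda>l. real (card (line_points X' Y' l))"
  have "?k l * ?k' l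
      \<le> r * ?k' l + (if r \<le> ?k l then (?k l)\<^sup>2 else 0) + (if r \<le> ?k' l then (?k' l)\<^sup>2 else 0)" for l
  proof (cases "r \<le> ?k l")
    case False
    then have "?k l * ?k' l \<le> r * ?k' l" by (intro mult_right_mono) auto
    then show ?thesis by (simp add: add_increasing2)
  next
    case True
    have "?k l * ?k' l \<le> (?k l)\<^sup>2" if "?k' l \<le> ?k l"
      using that by (simp add: power2_eq_square mult_left_mono)
    moreover have "?k l * ?k' l \<le> (?k' l)\<^sup>2" if "?k l \<le> ?k' l"
      using that by (simp add: power2_eq_square mult_right_mono)
    moreover have "0 \<le> r * ?k' l" using r_ge_4 by simp
    ultimately show ?thesis using True by (smt (verit) zero_le_power2)
  qed
  then have "(\<Sum>l\<in>L. ?k l * ?k' l)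
      \<le> (\<Sum>l\<in>L. r * ?k' l + (if r \<le> ?k l then (?k l)\<^sup>2 else 0)
          + (if r \<le> ?k' l then (?k' l)\<^sup>2 else 0))"
    by (rule sum_mono)
  also have "\<dots> = r * (\<Sum>l\<in>L. ?k' l) + (\<Sum>l\<in>{l\<in>L. r \<le> ?k l}. (?k l)\<^sup>2)
      + (\<Sum>l\<in>{l\<in>L. r \<le> ?k' l}. (?k' l)\<^sup>2)"
    using fin by (simp add: sum.distrib sum.inter_filter sum_distrib_left)
  also have "(\<Sum>l\<in>{l\<in>L. r \<le> ?k l}. (?k l)\<^sup>2) \<le> 128 * (real (card X) * card Y)\<^sup>2 / r"
    by (rule sum_rich_lines_squared_le) (use fin slope r_ge_4 in auto)
  also have "\<dots> \<le> 128 * K\<^sup>2 / r"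
    using grid_le r_ge_4 by (intro divide_right_mono mult_left_mono power_mono) auto
  also have "(\<Sum>l\<in>{l\<in>L. r \<le> ?k' l}. (?k' l)\<^sup>2) \<le> 128 * (real (card X') * card Y')\<^sup>2 / r"
    by (rule sum_rich_lines_squared_le) (use fin slope r_ge_4 in auto)
  also have "\<dots> \<le> 128 * K\<^sup>2 / r"
    using grid_le r_ge_4 by (intro divide_right_mono mult_left_mono power_mono) auto
  finally show ?thesis by simp
qed

subsection \<open>Multiplicative energy\<close>

definition multiplicative_energy :: "'a::field set \<Rightarrow> 'a set \<Rightarrow> nat" where
  "multiplicative_energy X Y = card (collisions (\<lambda>(x, y). y / x) (X \<times> Y))"

lemma card_ratio_fibre:
  fixes X Y :: "'a::field set"
  assumes "0 \<notin> X"
  shows "card {z \<in> X \<times> Y. (\<lambda>(x, y). y / x) z = m} = card {x\<in>X. m * x \<in> Y}"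
proof -
  have "{z \<in> X \<times> Y. (\<lambda>(x, y). y / x) z = m} = (\<lambda>x. (x, m * x)) ` {x\<in>X. m * x \<in> Y}"
    using assms by (force simp: image_iff)
  then show ?thesis by (simp add: card_image inj_on_def)
qed

lemma sum_card_rays_eq:
  fixes X Y :: "'a::field set"
  assumes "finite X" "finite Y" "0 \<notin> X"
  shows "(\<Sum>m\<in>(\<lambda>(x, y). y / x) ` (X \<times> Y). card {x\<in>X. m * x \<in> Y}) = card X * card Y"
  unfolding card_ratio_fibre[OF assms(3), symmetric] card_cartesian_product[symmetric]
  by (rule card_eq_sum_card_fibres[symmetric]) (use assms in auto)

lemma multiplicative_energy_eq_sum_squares:
  fixes X Y :: "'a::field set"
  assumes "finite X" "finite Y" "0 \<notin> X"
  shows "multiplicative_energy X Y = (\<Sum>m\<in>(\<lambda>(x, y). y / x) ` (X \<times> Y). (card {x\<in>X. m * x \<in> Y})\<^sup>2)"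
  unfolding card_ratio_fibre[OF assms(3), symmetric] multiplicative_energy_def
  by (rule card_collisions_eq_sum_squares) (use assms in auto)

lemma harm_le_Suc_ln:
  assumes "n > 0"
  shows "harm n \<le> 1 + ln (real n)"
proof -
  obtain m where "n = Suc m" using assms gr0_implies_Suc by blast
  moreover have "harm (Suc m) - ln (real (Suc m)) \<le> harm (Suc 0) - ln (real (Suc 0))"
    using decseq_harm_diff_ln by (rule decseqD) simp
  ultimately show ?thesis by (simp add: harm_expand)
qed

lemma harm_le_of_less_two_power:
  assumes "n < 2 ^ k"
  shows "harm n \<le> 2 * real k"
proof (cases "n = 0")
  case False
  then have "k \<noteq> 0" using assms by (intro notI) simp
  have "real n < real (2 ^ k)" using assms by (simp only: of_nat_less_iff)
  have "harm n \<le> 1 + ln (real n)" using False by (intro harm_le_Suc_ln) simp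
  also have "ln (real n) \<le> ln (2 ^ k)" using False \<open>real n < real (2 ^ k)\<close> by (intro ln_mono) auto
  also have "\<dots> = k * ln 2" by (simp add: ln_realpow)
  also have "\<dots> \<le> k" using ln_2_less_1 by (simp add: mult_left_le)
  finally show ?thesis using \<open>k \<noteq> 0\<close> by linarith
qed (simp add: harm_expand)

lemma sum_over_layers:
  fixes N :: "'a \<Rightarrow> nat" and h :: "nat \<Rightarrow> real"
  assumes "finite M" and N_le: "\<And>m. m \<in> M \<Longrightarrow> N m \<le> T"
  shows "(\<Sum>m\<in>M. \<Sum>j = 1..N m. h j) = (\<Sum>j = 1..T. card {m\<in>M. j \<le> N m} * h j)"
proof -
  have "{1..N m} = {j\<in>{1..T}. j \<le> N m}" if "m \<in> M" for m using N_le[OF that] by auto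
  then have "(\<Sum>m\<in>M. \<Sum>j = 1..N m. h j) = (\<Sum>m\<in>M. \<Sum>j\<in>{j\<in>{1..T}. j \<le> N m}. h j)"
    by (intro sum.cong) auto
  also have "\<dots> = (\<Sum>j = 1..T. \<Sum>m\<in>{m\<in>M. j \<le> N m}. h j)"
    by (rule sum.swap_restrict) (use assms(1) in auto)
  finally show ?thesis by simp
qed

text \<open>Since \<open>N\<^sup>2 \<le> (\<Sum>j = 1..N. 2 j)\<close>, a weak \<open>L\<^sup>2\<close> bound on the layers costs only a harmonic sum.\<close>

lemma sum_squares_le_of_layers:
  fixes N :: "'a \<Rightarrow> nat" and s K :: real
  assumes fin: "finite M" and N_le: "\<And>m. m \<in> M \<Longrightarrow> N m \<le> T" and nonneg: "0 \<le> s" "0 \<le> K"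
    and layers: "\<And>j. 1 \<le> j \<Longrightarrow> s < real j \<Longrightarrow> card {m\<in>M. j \<le> N m} \<le> K / (real j)\<^sup>2"
  shows "(\<Sum>m\<in>M. (real (N m))\<^sup>2) \<le> 2 * s * (\<Sum>m\<in>M. N m) + 2 * K * harm T"
proof -
  let ?layer = "\<lambda>j. {m\<in>M. j \<le> N m}"
  have "(\<Sum>m\<in>M. (real (N m))\<^sup>2) \<le> (\<Sum>m\<in>M. \<Sum>j = 1..N m. 2 * real j)"
    using double_gauss_sum_from_Suc_0[where ?'a = real]
    by (intro sum_mono) (simp add: power2_eq_square distrib_left flip: sum_distrib_left)
  also have "\<dots> = (\<Sum>j = 1..T. card (?layer j) * (2 * real j))" by (rule sum_over_layers[OF fin N_le])
  also have "\<dots> \<le> (\<Sum>j = 1..T. 2 * s * card (?layer j) + 2 * K * inverse (real j))"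
  proof (rule sum_mono)
    fix j assume j_range: "j \<in> {1..T}"
    show "card (?layer j) * (2 * real j) \<le> 2 * s * card (?layer j) + 2 * K * inverse (real j)"
    proof (cases "real j \<le> s")
      case True
      then have "card (?layer j) * (2 * real j) \<le> card (?layer j) * (2 * s)" by (intro mult_left_mono) auto
      also have "\<dots> \<le> 2 * s * card (?layer j) + 2 * K * inverse (real j)" using nonneg by simp
      finally show ?thesis .
    next
      case False
      then have "card (?layer j) * (2 * real j) \<le> K / (real j)\<^sup>2 * (2 * real j)"
        using layers[of j] j_range by (intro mult_right_mono) auto
      also have "\<dots> = 2 * K * inverse (real j)" using j_range by (simp add: field_simps power2_eq_square)
      also have "\<dots> \<le> 2 * s * card (?layer j) + 2 * K * inverse (real j)" using nonneg by simp
      finally show ?thesis .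
    qed
  qed
  also have "\<dots> = 2 * s * (\<Sum>j = 1..T. card (?layer j)) + 2 * K * harm T"
    by (simp add: sum.distrib sum_distrib_left harm_def)
  also have "real (\<Sum>j = 1..T. card (?layer j)) = (\<Sum>m\<in>M. N m)"
    using sum_over_layers[OF fin N_le, where h = "\<lambda>_. 1"] by simp
  finally show ?thesis .
qed

definition shift_lines :: "'a::linordered_field set \<Rightarrow> 'a set \<Rightarrow> ('a \<times> 'a) set" where
  "shift_lines M Q = (\<lambda>(m, q, q'). (m, - m * q - q')) ` (M \<times> Q \<times> Q)"

lemma shift_linesI: "m \<in> M \<Longrightarrow> q \<in> Q \<Longrightarrow> q' \<in> Q \<Longrightarrow> (m, - m * q - q') \<in> shift_lines M Q"
  by (force simp: shift_lines_def)

lemma finite_shift_lines [simp]: "finite M \<Longrightarrow> finite Q \<Longrightarrow> finite (shift_lines M Q)"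
  by (simp add: shift_lines_def)

lemma sum_card_shift_lines_le:
  assumes "finite M" "finite Q"
  shows "(\<Sum>l\<in>shift_lines M Q. card (line_points Q (uminus ` Q) l)) \<le> card M * (card Q)\<^sup>2"
proof -
  have "(\<Sum>l\<in>shift_lines M Q. card (line_points Q (uminus ` Q) l))
      = card (SIGMA l:shift_lines M Q. line_points Q (uminus ` Q) l)"
    using assms by simp
  also have "\<dots> \<le> card (M \<times> Q \<times> Q)"
  proof (rule card_inj_on_le[of "\<lambda>(l, q). (fst l, q, - line_at l q)"])
    show "inj_on (\<lambda>(l, q). (fst l, q, - line_at l q)) (SIGMA l:shift_lines M Q. line_points Q (uminus ` Q) l)"
      by (auto simp: inj_on_def line_at_def)
  qed (use assms in \<open>auto simp: shift_lines_def line_points_def\<close>)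
  finally show ?thesis by (simp add: card_cartesian_product power2_eq_square)
qed

locale popular_sums =
  fixes P Q R P' R' :: "'a::linordered_field set" and t d :: real
  assumes finite: "finite P" "finite Q" "finite R"
    and card_le: "card P \<le> t" "card Q \<le> t" "card R \<le> t"
    and subset: "P' \<subseteq> P" "R' \<subseteq> R"
    and popular_sum: "p \<in> P' \<Longrightarrow> d \<le> card {q\<in>Q. p + q \<in> R}"
    and popular_difference: "r \<in> R' \<Longrightarrow> d \<le> card {q\<in>Q. r - q \<in> P}"
    and d_pos: "0 < d" and t_ge_1: "1 \<le> t"
begin

lemma finite_popular: "finite P'" "finite R'"
  using finite subset by (auto intro: finite_subset)

text \<open>Every point \<open>(p, m p)\<close> of a ray can be shifted into the grid \<open>R \<times> P\<close> by at least \<open>d\<^sup>2\<close> vectors of \<open>Q \<times> - Q\<close>,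
  so a rich ray produces many rich lines parallel to it (an argument of Elekes and Ruzsa).\<close>

lemma card_mult_le_sum_shift_lines:
  fixes s :: real
  assumes finM: "finite M" and rich: "\<And>m. m \<in> M \<Longrightarrow> s \<le> card {p\<in>P'. m * p \<in> R'}"
  shows "card M * (s * d\<^sup>2)
    \<le> (\<Sum>l\<in>shift_lines M Q. real (card (line_points R P l)) * card (line_points Q (uminus ` Q) l))"
proof -
  let ?ray = "\<lambda>m. {p\<in>P'. m * p \<in> R'}"
  let ?shifts = "\<lambda>m p. {q\<in>Q. p + q \<in> R} \<times> {q\<in>Q. m * p - q \<in> P}"
  let ?shifted = "SIGMA m:M. SIGMA p:?ray m. ?shifts m p"
  let ?points = "SIGMA l:shift_lines M Q. line_points R P l \<times> line_points Q (uminus ` Q) l"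
  have "card M * (s * d\<^sup>2) = (\<Sum>m\<in>M. s * d\<^sup>2)" by simp
  also have "\<dots> \<le> (\<Sum>m\<in>M. card (?ray m) * d\<^sup>2)"
    by (intro sum_mono mult_right_mono rich) auto
  also have "\<dots> = (\<Sum>m\<in>M. \<Sum>p\<in>?ray m. d * d)" by (simp add: power2_eq_square)
  also have "\<dots> \<le> (\<Sum>m\<in>M. \<Sum>p\<in>?ray m. real (card {q\<in>Q. p + q \<in> R}) * card {q\<in>Q. m * p - q \<in> P})"
    using d_pos by (intro sum_mono mult_mono popular_sum popular_difference) auto
  also have "\<dots> = card ?shifted"
    using finM finite finite_popular by (simp add: card_cartesian_product)
  also have "\<dots> \<le> card ?points"
  proof (intro of_nat_mono card_inj_on_le[of "\<lambda>(m, p, q, q'). ((m, - m * q - q'), (p + q, q))"])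
    show "(\<lambda>(m, p, q, q'). ((m, - m * q - q'), (p + q, q))) ` ?shifted \<subseteq> ?points"
      by (auto intro!: shift_linesI[simplified] imageI[of _ Q uminus] simp: line_points_def line_at_def distrib_left)
  qed (use finM finite in \<open>auto simp: inj_on_def\<close>)
  also have "\<dots> = (\<Sum>l\<in>shift_lines M Q. real (card (line_points R P l)) * card (line_points Q (uminus ` Q) l))"
    using finM finite by (simp add: card_cartesian_product)
  finally show ?thesis .
qed

lemma card_rich_ratios_le:
  fixes s :: real
  assumes finM: "finite M" and "0 \<notin> M" and rich: "\<And>m. m \<in> M \<Longrightarrow> s \<le> card {p\<in>P'. m * p \<in> R'}"
    and s_large: "8 * t\<^sup>2 / d\<^sup>2 \<le> s"
  shows "card M \<le> 1024 * t ^ 6 / (d ^ 4 * s\<^sup>2)"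
proof -
  let ?L = "shift_lines M Q"
  let ?k = "\<lambda>l. real (card (line_points R P l))" and ?k' = "\<lambda>l. real (card (line_points Q (uminus ` Q) l))"
  have t_pos: "0 < t" using t_ge_1 by simp
  have "0 < 8 * t\<^sup>2 / d\<^sup>2" using t_pos d_pos by simp
  then have s_pos: "0 < s" using s_large by linarith
  define r where "r = s * d\<^sup>2 / (2 * t\<^sup>2)"
  have r_ge_4: "4 \<le> r" using s_large d_pos t_pos by (simp add: r_def field_simps)
  have "card M * (s * d\<^sup>2) \<le> (\<Sum>l\<in>?L. ?k l * ?k' l)"
    by (rule card_mult_le_sum_shift_lines[OF finM rich])
  also have "\<dots> \<le> r * (\<Sum>l\<in>?L. card (line_points Q (uminus ` Q) l)) + 256 * (t\<^sup>2)\<^sup>2 / r"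
  proof (rule sum_mult_card_line_points_le)
    show "fst l \<noteq> 0" if "l \<in> ?L" for l using that \<open>0 \<notin> M\<close> by (auto simp: shift_lines_def)
    show "real (card R) * card P \<le> t\<^sup>2" "real (card Q) * card (uminus ` Q) \<le> t\<^sup>2"
      unfolding power2_eq_square using card_le by (auto intro!: mult_mono simp: card_image)
  qed (use finite finM r_ge_4 in auto)
  also have "(\<Sum>l\<in>?L. card (line_points Q (uminus ` Q) l)) \<le> card M * t\<^sup>2"
  proof -
    have "real (\<Sum>l\<in>?L. card (line_points Q (uminus ` Q) l)) \<le> real (card M * (card Q)\<^sup>2)"
      by (intro of_nat_mono sum_card_shift_lines_le finM finite)
    also have "\<dots> \<le> card M * t\<^sup>2" using card_le by (simp add: mult_left_mono power_mono)
    finally show ?thesis .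
  qed
  also have "r * (card M * t\<^sup>2) = card M * (s * d\<^sup>2) / 2" using t_pos by (simp add: r_def)
  finally have "card M * (s * d\<^sup>2) \<le> 512 * (t\<^sup>2)\<^sup>2 / r" using r_ge_4 by (simp add: mult_left_mono)
  also have "\<dots> = 1024 * t ^ 6 / (s * d\<^sup>2)"
    using t_pos d_pos s_pos by (simp add: r_def field_simps power_numeral_reduce)
  finally show ?thesis
    using s_pos d_pos by (simp add: field_simps power_numeral_reduce)
qed

lemma d_le_t:
  assumes "P' \<noteq> {}"
  shows "d \<le> t"
proof -
  obtain p where "p \<in> P'" using assms by auto
  then have "d \<le> card {q\<in>Q. p + q \<in> R}" by (rule popular_sum)
  also have "\<dots> \<le> card Q" using finite by (intro of_nat_mono card_mono) auto
  finally show ?thesis using card_le by simp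
qed

lemma card_popular_le: "card P' \<le> t" "card R' \<le> t"
proof -
  have "card P' \<le> card P" "card R' \<le> card R" using finite subset by (auto intro: card_mono)
  then show "card P' \<le> t" "card R' \<le> t" using card_le by linarith+
qed

lemma multiplicative_energy_le:
  assumes nonzero: "0 \<notin> P'" "0 \<notin> R'" and t_less: "t < 2 ^ k"
  shows "multiplicative_energy P' R' \<le> 4112 * real k * t ^ 6 / d ^ 4"
proof (cases "P' = {}")
  case True
  then show ?thesis using t_ge_1 by (simp add: multiplicative_energy_def collisions_def)
next
  case False
  define M where "M = (\<lambda>(x, y). y / x) ` (P' \<times> R')"
  define N where "N m = card {p\<in>P'. m * p \<in> R'}" for m
  have finM: "finite M" and zero_notin_M: "0 \<notin> M"
    using finite_popular nonzero by (auto simp: M_def)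
  have N_le: "N m \<le> card P'" for m
    unfolding N_def using finite_popular by (intro card_mono) auto
  have "(\<Sum>m\<in>M. N m) = card P' * card R'"
    unfolding M_def N_def by (rule sum_card_rays_eq[OF finite_popular nonzero(1)])
  then have sum_N: "(\<Sum>m\<in>M. N m) \<le> t\<^sup>2"
    using card_popular_le by (simp add: power2_eq_square mult_mono)
  have "real (card P') < 2 ^ k" using card_popular_le(1) t_less by linarith
  then have "card P' < 2 ^ k" by simp
  then have harm_le: "harm (card P') \<le> 2 * real k" by (rule harm_le_of_less_two_power)
  have "multiplicative_energy P' R' = (\<Sum>m\<in>M. (N m)\<^sup>2)"
    unfolding M_def N_def by (rule multiplicative_energy_eq_sum_squares[OF finite_popular nonzero(1)])
  then have "multiplicative_energy P' R' = (\<Sum>m\<in>M. (real (N m))\<^sup>2)" by simp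
  also have "\<dots> \<le> 2 * (8 * t\<^sup>2 / d\<^sup>2) * (\<Sum>m\<in>M. N m) + 2 * (1024 * t ^ 6 / d ^ 4) * harm (card P')"
  proof (rule sum_squares_le_of_layers[OF finM N_le])
    fix j :: nat assume j_large: "8 * t\<^sup>2 / d\<^sup>2 < j"
    have "card {m\<in>M. j \<le> N m} \<le> 1024 * t ^ 6 / (d ^ 4 * (real j)\<^sup>2)"
      by (rule card_rich_ratios_le) (use finM zero_notin_M j_large in \<open>auto simp: N_def\<close>)
    then show "card {m\<in>M. j \<le> N m} \<le> 1024 * t ^ 6 / d ^ 4 / (real j)\<^sup>2" by simp
  qed (use t_ge_1 d_pos in auto)
  also have "\<dots> \<le> 2 * (8 * t\<^sup>2 / d\<^sup>2) * t\<^sup>2 + 2 * (1024 * t ^ 6 / d ^ 4) * (2 * real k)"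
    using t_ge_1 d_pos by (intro add_mono mult_left_mono sum_N harm_le) auto
  also have "2 * (8 * t\<^sup>2 / d\<^sup>2) * t\<^sup>2 \<le> 16 * t ^ 6 / d ^ 4 * real k"
  proof -
    have "k \<noteq> 0" using t_less t_ge_1 by (intro notI) simp
    have "16 * t ^ 4 * d\<^sup>2 \<le> 16 * t ^ 4 * t\<^sup>2" using d_le_t[OF False] d_pos by (intro mult_left_mono power_mono) auto
    also have "\<dots> \<le> 16 * t ^ 4 * t\<^sup>2 * real k" using \<open>k \<noteq> 0\<close> t_ge_1 by simp
    finally show ?thesis using d_pos by (simp add: field_simps power_numeral_reduce)
  qed
  finally show ?thesis by (simp add: field_simps)
qed

end

subsection \<open>Regular families of fibres\<close>

lemma floor_log_bounds:
  assumes "0 < n"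
  shows "2 ^ floor_log n \<le> real n" "real n \<le> 2 * 2 ^ floor_log n"
proof -
  have "real (2 ^ floor_log n) \<le> real n" "real n \<le> real (2 * 2 ^ floor_log n)"
    using floor_log_exp2_le[OF assms] floor_log_exp2_ge[of n] by (simp_all only: of_nat_le_iff)
  then show "2 ^ floor_log n \<le> real n" "real n \<le> 2 * 2 ^ floor_log n" by simp_all
qed

lemma dyadic_pigeonhole:
  fixes g :: "'a \<Rightarrow> nat" and w :: "'a \<Rightarrow> real"
  assumes "finite X" "0 < k" and g_less: "\<And>x. x \<in> X \<Longrightarrow> g x < 2 ^ k"
  obtains j where "sum w X \<le> k * sum w {x\<in>X. floor_log (g x) = j}"
proof -
  have "floor_log (g x) < k" if "x \<in> X" for x
  proof (cases "g x = 0")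
    case False
    then have "(2 :: nat) ^ floor_log (g x) < 2 ^ k"
      using floor_log_exp2_le[of "g x"] g_less[OF that] by linarith
    then show ?thesis by simp
  qed (use assms(2) in simp)
  then have "(\<Sum>j<k. sum w {x\<in>X. floor_log (g x) = j}) = sum w X"
    by (intro sum.group) (use assms(1) in auto)
  then show thesis
    using exists_ge_average[of "{..<k}" "sum w X / k" "\<lambda>j. sum w {x\<in>X. floor_log (g x) = j}"] assms(2) that
    by (auto simp: field_simps)
qed

lemma exists_regular_subfamily:
  fixes X :: "'i \<Rightarrow> 'a set" and f :: "'a \<Rightarrow> 'b"
  assumes "finite I" and fin: "\<And>i. i \<in> I \<Longrightarrow> finite (X i)" and "0 < k"
    and fibre: "\<And>i x. i \<in> I \<Longrightarrow> x \<in> X i \<Longrightarrow> card {x'\<in>X i. f x' = f x} < 2 ^ k"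
  obtains r :: real and G where "0 < r" "\<And>i. i \<in> I \<Longrightarrow> G i \<subseteq> X i"
    "real (\<Sum>i\<in>I. card (X i)) \<le> real k * (\<Sum>i\<in>I. card (G i))"
    "\<And>i x. i \<in> I \<Longrightarrow> x \<in> G i \<Longrightarrow> r \<le> card {x'\<in>G i. f x' = f x} \<and> card {x'\<in>G i. f x' = f x} \<le> 2 * r"
proof -
  define N where "N = (\<lambda>(i, x). card {x'\<in>X i. f x' = f x})"
  obtain j where level: "(\<Sum>x\<in>Sigma I X. 1) \<le> real k * (\<Sum>x\<in>{x\<in>Sigma I X. floor_log (N x) = j}. 1)"
    by (rule dyadic_pigeonhole[of "Sigma I X" k N "\<lambda>_. 1"]) (use assms in \<open>auto simp: N_def\<close>)
  define G where "G i = {x\<in>X i. floor_log (N (i, x)) = j}" for i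
  have "{x\<in>Sigma I X. floor_log (N x) = j} = Sigma I G" by (auto simp: G_def)
  with level have large: "real (\<Sum>i\<in>I. card (X i)) \<le> real k * (\<Sum>i\<in>I. card (G i))"
    using assms(1) fin by (simp add: G_def)
  define r :: real where "r = 2 ^ j"
  have "r \<le> card {x'\<in>G i. f x' = f x} \<and> card {x'\<in>G i. f x' = f x} \<le> 2 * r"
    if "i \<in> I" "x \<in> G i" for i x
  proof -
    have "{x'\<in>G i. f x' = f x} = {x'\<in>X i. f x' = f x}"
      using that(2) by (auto simp: G_def N_def)
    moreover have "x \<in> {x'\<in>X i. f x' = f x}" using that(2) by (simp add: G_def)
    then have "0 < N (i, x)" using fin[OF that(1)] by (auto simp: N_def card_gt_0_iff)
    then have "r \<le> N (i, x)" "N (i, x) \<le> 2 * r"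
      using that(2) floor_log_bounds[of "N (i, x)"] by (auto simp: G_def r_def)
    ultimately show ?thesis by (simp add: N_def)
  qed
  then show thesis by (intro that[of r G] large) (auto simp: G_def r_def)
qed

lemma exists_popular_subfamily:
  fixes G :: "'i \<Rightarrow> 'a set" and f :: "'a \<Rightarrow> 'b" and r :: real
  assumes "finite I" and fin: "\<And>i. i \<in> I \<Longrightarrow> finite (G i)" and "finite H" "0 < r"
    and image_H: "\<And>i. i \<in> I \<Longrightarrow> f ` G i \<subseteq> H"
    and fibre: "\<And>i x. i \<in> I \<Longrightarrow> x \<in> G i \<Longrightarrow> card {x'\<in>G i. f x' = f x} \<le> 2 * r"
  obtains G' where "\<And>i. i \<in> I \<Longrightarrow> G' i \<subseteq> G i" "(\<Sum>i\<in>I. card (G i)) \<le> 2 * (\<Sum>i\<in>I. card (G' i))"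
    "\<And>i x. i \<in> I \<Longrightarrow> x \<in> G' i \<Longrightarrow> (\<Sum>i\<in>I. card (G i)) \<le> 4 * r * card H * card {j\<in>I. f x \<in> f ` G j}"
proof -
  define popular where
    "popular y \<longleftrightarrow> real (\<Sum>i\<in>I. card (G i)) \<le> 4 * r * card H * card {j\<in>I. y \<in> f ` G j}" for y
  let ?good = "\<lambda>i. {x\<in>G i. popular (f x)}" and ?bad = "\<lambda>i. {x\<in>G i. \<not> popular (f x)}"
  let ?rare = "{y\<in>H. \<not> popular y}"
  have bad: "card (?bad i) \<le> 2 * r * card {y\<in>?rare. y \<in> f ` G i}" if i: "i \<in> I" for i
  proof (rule card_le_mult_fibres[where f = f])
    fix y assume "y \<in> {y\<in>?rare. y \<in> f ` G i}"
    then obtain x where x_in_fibre: "x \<in> G i" "y = f x" by auto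
    have "card {x\<in>?bad i. f x = y} \<le> card {x'\<in>G i. f x' = f x}"
      unfolding x_in_fibre(2) using fin[OF i] by (intro card_mono) auto
    then show "card {x\<in>?bad i. f x = y} \<le> 2 * r" using fibre[OF i x_in_fibre(1)] by linarith
  qed (use fin[OF i] image_H[OF i] assms(3) in auto)
  have "(\<Sum>i\<in>I. card {y\<in>?rare. y \<in> f ` G i}) = (\<Sum>y\<in>?rare. card {i\<in>I. y \<in> f ` G i})"
    by (rule sum_multicount_gen) (use assms in auto)
  then have "4 * r * card H * (\<Sum>i\<in>I. card {y\<in>?rare. y \<in> f ` G i})
      = (\<Sum>y\<in>?rare. 4 * r * card H * card {i\<in>I. y \<in> f ` G i})"
    by (simp add: sum_distrib_left)
  also have "\<dots> \<le> card ?rare * real (\<Sum>i\<in>I. card (G i))"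
    by (rule sum_bounded_above) (simp add: popular_def)
  also have "\<dots> \<le> card H * real (\<Sum>i\<in>I. card (G i))"
    using assms(3) by (intro mult_right_mono of_nat_mono card_mono of_nat_0_le_iff) auto
  finally have rare: "4 * r * (\<Sum>i\<in>I. card {y\<in>?rare. y \<in> f ` G i}) \<le> (\<Sum>i\<in>I. card (G i))"
    if "card H > 0" using that by (simp add: mult_ac)
  have "2 * (2 * r * (\<Sum>i\<in>I. card {y\<in>?rare. y \<in> f ` G i})) \<le> (\<Sum>i\<in>I. card (G i))"
  proof (cases "H = {}")
    case False
    then show ?thesis using rare assms(3) by (simp add: card_gt_0_iff)
  qed (simp del: of_nat_sum)
  moreover have "(\<Sum>i\<in>I. card (?bad i)) \<le> 2 * r * (\<Sum>i\<in>I. card {y\<in>?rare. y \<in> f ` G i})"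
    using sum_mono[OF bad] by (simp add: sum_distrib_left)
  moreover have "card (G i) = card (?good i) + card (?bad i)" if "i \<in> I" for i
    using fin[OF that] by (subst card_Un_disjoint[symmetric]) (auto intro: arg_cong[of _ _ card])
  then have "(\<Sum>i\<in>I. card (G i)) = (\<Sum>i\<in>I. card (?good i)) + (\<Sum>i\<in>I. card (?bad i))"
    by (simp add: sum.distrib)
  ultimately have "real (\<Sum>i\<in>I. card (G i)) \<le> real (2 * (\<Sum>i\<in>I. card (?good i)))" by simp
  then have "(\<Sum>i\<in>I. card (G i)) \<le> 2 * (\<Sum>i\<in>I. card (?good i))" by (simp only: of_nat_le_iff)
  then show thesis by (rule that[rotated]) (auto simp: popular_def)
qed

lemma exists_regular_popular_subfamily:
  fixes X :: "'i \<Rightarrow> 'a set" and f :: "'a \<Rightarrow> 'b"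
  assumes "finite I" and fin: "\<And>i. i \<in> I \<Longrightarrow> finite (X i)" and "finite H" "0 < k"
    and image_H: "\<And>i. i \<in> I \<Longrightarrow> f ` X i \<subseteq> H"
    and fibre: "\<And>i x. i \<in> I \<Longrightarrow> x \<in> X i \<Longrightarrow> card {x'\<in>X i. f x' = f x} < 2 ^ k"
  obtains r :: real and Q G where "0 < r" "\<And>i. i \<in> I \<Longrightarrow> G i \<subseteq> X i"
    "\<And>i. i \<in> I \<Longrightarrow> Q i \<subseteq> f ` X i" "\<And>i. i \<in> I \<Longrightarrow> f ` G i \<subseteq> Q i"
    "\<And>i. i \<in> I \<Longrightarrow> r * card (Q i) \<le> card (X i)"
    "real (\<Sum>i\<in>I. card (X i)) \<le> 2 * real k * (\<Sum>i\<in>I. card (G i))"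
    "\<And>i x. i \<in> I \<Longrightarrow> x \<in> G i \<Longrightarrow> real (\<Sum>i\<in>I. card (X i)) \<le> 4 * real k * r * card H * card {j\<in>I. f x \<in> Q j}"
proof -
  obtain r :: real and F where r_pos: "0 < r" and F_subset: "\<And>i. i \<in> I \<Longrightarrow> F i \<subseteq> X i"
    and F_large: "real (\<Sum>i\<in>I. card (X i)) \<le> real k * (\<Sum>i\<in>I. card (F i))"
    and F_fibre: "\<And>i x. i \<in> I \<Longrightarrow> x \<in> F i \<Longrightarrow>
      r \<le> card {x'\<in>F i. f x' = f x} \<and> card {x'\<in>F i. f x' = f x} \<le> 2 * r"
    by (rule exists_regular_subfamily[of I X k f, OF assms(1) fin assms(4) fibre]) auto
  have finF: "finite (F i)" if "i \<in> I" for i using F_subset[OF that] fin[OF that] by (rule finite_subset)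
  have FH: "f ` F i \<subseteq> H" if "i \<in> I" for i using F_subset[OF that] image_H[OF that] by auto
  obtain G where G_subset: "\<And>i. i \<in> I \<Longrightarrow> G i \<subseteq> F i"
    and G_large: "(\<Sum>i\<in>I. card (F i)) \<le> 2 * (\<Sum>i\<in>I. card (G i))"
    and G_popular: "\<And>i x. i \<in> I \<Longrightarrow> x \<in> G i \<Longrightarrow>
      real (\<Sum>i\<in>I. card (F i)) \<le> 4 * r * card H * card {j\<in>I. f x \<in> f ` F j}"
    by (rule exists_popular_subfamily[of I F H r f]) (use assms finF FH r_pos F_fibre in auto)
  have card_Q: "r * card (f ` F i) \<le> card (X i)" if i: "i \<in> I" for i
  proof -
    have "r * card (f ` F i) \<le> card (F i)"
      by (rule mult_card_image_le_card) (use finF[OF i] F_fibre[OF i] in auto)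
    also have "\<dots> \<le> card (X i)" using fin[OF i] F_subset[OF i] by (intro of_nat_mono card_mono)
    finally show ?thesis .
  qed
  have popular: "real (\<Sum>i\<in>I. card (X i)) \<le> 4 * real k * r * card H * card {j\<in>I. f x \<in> f ` F j}"
    if "i \<in> I" "x \<in> G i" for i x
  proof -
    have "real k * real (\<Sum>i\<in>I. card (F i)) \<le> real k * (4 * r * card H * card {j\<in>I. f x \<in> f ` F j})"
      using G_popular[OF that] by (rule mult_left_mono) simp
    then show ?thesis using F_large by (simp only: mult_ac)
  qed
  have large: "real (\<Sum>i\<in>I. card (X i)) \<le> 2 * real k * (\<Sum>i\<in>I. card (G i))"
  proof -
    have "real k * real (\<Sum>i\<in>I. card (F i)) \<le> real k * real (2 * (\<Sum>i\<in>I. card (G i)))"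
      by (intro mult_left_mono of_nat_mono G_large) simp
    then show ?thesis using F_large by simp
  qed
  show thesis
  proof (rule that)
    show "G i \<subseteq> X i" "f ` F i \<subseteq> f ` X i" "f ` G i \<subseteq> f ` F i" if "i \<in> I" for i
      using F_subset[OF that] G_subset[OF that] by auto
  qed (fact r_pos card_Q large popular)+
qed

subsection \<open>Coincidences of sums on nearby rays\<close>

definition dilation_part :: "real set \<Rightarrow> real \<Rightarrow> real set" where
  "dilation_part A l = {a\<in>A. l * a \<in> A}"

lemma dilation_part_subset: "dilation_part A l \<subseteq> A"
  by (auto simp: dilation_part_def)

lemma finite_dilation_part [simp]: "finite A \<Longrightarrow> finite (dilation_part A l)"
  by (simp add: dilation_part_def)

lemma finite_sumset [simp]: "finite A \<Longrightarrow> finite (sumset A)"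
  unfolding sumset_def by (rule finite_image_set2) auto

lemma two_ray_decomposition_unique:
  fixes l m p q p' q' :: "'a::field"
  assumes "l \<noteq> m" "p + q = p' + q'" "l * p + m * q = l * p' + m * q'"
  shows "p = p'" "q = q'"
proof -
  have "(l - m) * (p - p') = 0" using assms(2,3) by algebra
  then show "p = p'" using assms(1) by simp
  then show "q = q'" using assms(2) by simp
qed

lemma block_index_weighted_mean:
  fixes l m p q :: "'a::linordered_field"
  assumes "finite S" "0 < p" "0 < q" "block_index S g l = block_index S g m"
  shows "block_index S g ((l * p + m * q) / (p + q)) = block_index S g l"
proof -
  have "min l m * (p + q) \<le> l * p + m * q" "l * p + m * q \<le> max l m * (p + q)"
    using assms(2,3) by (simp_all add: distrib_left add_mono mult_right_mono)
  then have "min l m \<le> (l * p + m * q) / (p + q)" "(l * p + m * q) / (p + q) \<le> max l m"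
    using assms(2,3) by (simp_all add: pos_le_divide_eq pos_divide_le_eq)
  then have "block_index S g (min l m) \<le> block_index S g ((l * p + m * q) / (p + q))"
    "block_index S g ((l * p + m * q) / (p + q)) \<le> block_index S g (max l m)"
    using monoD[OF mono_block_index[OF assms(1)]] by blast+
  then show ?thesis using assms(4) by (simp add: min_def max_def split: if_splits)
qed

text \<open>A point \<open>(l, a, p)\<close> stands for the dilate by \<open>a\<close> of the point \<open>(p, l p)\<close> of \<open>A \<times> A\<close> on the ray of slope \<open>l\<close>.\<close>

type_synonym ray_point = "real \<times> real \<times> real"

locale ray_points =
  fixes A S :: "real set" and G :: "real \<Rightarrow> (real \<times> real) set"
  assumes finite_A: "finite A" and A_pos: "a \<in> A \<Longrightarrow> 0 < a" and finite_S: "finite S"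
    and G_subset: "l \<in> S \<Longrightarrow> G l \<subseteq> A \<times> dilation_part A l"
begin

definition points :: "ray_point set" where
  "points = (SIGMA l:S. G l)"

definition block_pairs :: "nat \<Rightarrow> (ray_point \<times> ray_point) set" where
  "block_pairs g = {((l, a, p), (m, b, q)). (l, a, p) \<in> points \<and> (m, b, q) \<in> points \<and>
     a = b \<and> l \<noteq> m \<and> block_index S g l = block_index S g m}"

definition pair_sum :: "ray_point \<times> ray_point \<Rightarrow> real \<times> real \<times> real" where
  "pair_sum = (\<lambda>((l, a, p), (m, b, q)). (a, p + q, l * p + m * q))"

definition genuine_collisions ::
  "nat \<Rightarrow> ((ray_point \<times> ray_point) \<times> (ray_point \<times> ray_point)) set" where
  "genuine_collisions g = {((x, y), (x', y')). ((x, y), (x', y')) \<in> collisions pair_sum (block_pairs g) \<and>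
     fst y' \<notin> {fst x, fst y}}"

definition block_quadruples :: "nat \<Rightarrow> (real \<times> real \<times> real \<times> real) set" where
  "block_quadruples g = {(l\<^sub>1, l\<^sub>2, l\<^sub>3, l\<^sub>4). l\<^sub>1 \<in> S \<and> l\<^sub>2 \<in> S \<and> l\<^sub>3 \<in> S \<and> l\<^sub>4 \<in> S \<and> l\<^sub>4 \<notin> {l\<^sub>1, l\<^sub>2, l\<^sub>3} \<and>
     (\<forall>l\<in>{l\<^sub>2, l\<^sub>3, l\<^sub>4}. block_index S g l = block_index S g l\<^sub>1)}"

definition solutions :: "real \<times> real \<times> real \<times> real \<Rightarrow> (real \<times> real \<times> real \<times> real) set" where
  "solutions = (\<lambda>(l\<^sub>1, l\<^sub>2, l\<^sub>3, l\<^sub>4). {(a, p\<^sub>1, p\<^sub>2, p\<^sub>3). (a, p\<^sub>1) \<in> G l\<^sub>1 \<and> (a, p\<^sub>2) \<in> G l\<^sub>2 \<and> (a, p\<^sub>3) \<in> G l\<^sub>3 \<and>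
     (l\<^sub>1 - l\<^sub>4) * p\<^sub>1 + (l\<^sub>2 - l\<^sub>4) * p\<^sub>2 = (l\<^sub>3 - l\<^sub>4) * p\<^sub>3})"

lemma pointsD:
  assumes "(l, a, p) \<in> points"
  shows "l \<in> S" "(a, p) \<in> G l" "a \<in> A" "p \<in> A" "l * p \<in> A" "p \<in> dilation_part A l" "0 < p"
  using assms G_subset A_pos by (auto simp: points_def dilation_part_def)

lemma finite_G: "l \<in> S \<Longrightarrow> finite (G l)"
  by (rule finite_subset[OF G_subset]) (use finite_A in auto)

lemma finite_points [simp]: "finite points"
  using finite_S finite_G by (simp add: points_def)

lemma card_points: "card points = (\<Sum>l\<in>S. card (G l))"
  using finite_S finite_G by (simp add: points_def)

lemma block_pairs_eq:
  "block_pairs g = collisions (\<lambda>(l, a, p). (a, block_index S g l)) points - collisions (\<lambda>(l, a, p). (a, l)) points"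
  by (auto simp: block_pairs_def collisions_def)

lemma finite_block_pairs [simp]: "finite (block_pairs g)"
  by (simp add: block_pairs_eq)

lemma card_block_index_image_le:
  assumes "0 < g" "g \<le> card S"
  shows "card (block_index S g ` S) \<le> 2 * real (card S) / g"
proof -
  have "card S \<le> (card S div g + 1) * g"
    using dividend_less_times_div[OF assms(1), of "card S"] by (simp add: mult.commute)
  then have "block_index S g ` S \<subseteq> {..<card S div g + 1}"
    using finite_S by (auto intro: block_index_less)
  then have "card (block_index S g ` S) \<le> card {..<card S div g + 1}"
    by (rule card_mono[rotated]) simp
  then have "real (card (block_index S g ` S)) \<le> real (card S div g) + 1" by simp
  also have "real (card S div g) \<le> card S / g" by (rule of_nat_div_le_of_nat)
  also have "1 \<le> card S / g" using assms by simp
  finally show ?thesis by simp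
qed

lemma card_points_squared_le:
  fixes c :: real
  assumes "0 < g" "g \<le> card S" and fibre: "\<And>l. l \<in> S \<Longrightarrow> card (dilation_part A l) \<le> c"
  shows "(real (card points))\<^sup>2 \<le> card A * (2 * real (card S) / g) * (card (block_pairs g) + c * card points)"
proof -
  let ?same_block = "collisions (\<lambda>(l, a, p). (a, block_index S g l)) points"
  let ?same_ray = "collisions (\<lambda>(l, a, p). (a, l)) points"
  have "card ?same_ray \<le> c * card points"
  proof (rule card_collisions_le)
    fix x assume "x \<in> points"
    then obtain l a p where x_point: "x = (l, a, p)" "(l, a, p) \<in> points" by (cases x) auto
    have "card {x'\<in>points. (case x' of (l, a, p) \<Rightarrow> (a, l)) = (case x of (l, a, p) \<Rightarrow> (a, l))}
        \<le> card (dilation_part A l)"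
      by (rule card_inj_on_le[of "\<lambda>(l, a, p). p"]) (use finite_A x_point pointsD in \<open>auto simp: inj_on_def\<close>)
    then show "card {x'\<in>points. (case x' of (l, a, p) \<Rightarrow> (a, l)) = (case x of (l, a, p) \<Rightarrow> (a, l))} \<le> c"
      using fibre[OF pointsD(1)[OF x_point(2)]] by linarith
  qed simp
  moreover have "card ?same_block \<le> card (block_pairs g) + card ?same_ray"
    unfolding block_pairs_eq using diff_card_le_card_Diff[of ?same_ray ?same_block] by simp
  ultimately have same_block: "card ?same_block \<le> card (block_pairs g) + c * card points" by linarith
  have "(card points)\<^sup>2 \<le> card (A \<times> block_index S g ` S) * card ?same_block"
    by (rule card_squared_le_card_collisions) (use finite_A finite_S pointsD in auto)
  then have "real ((card points)\<^sup>2) \<le> real (card A * card (block_index S g ` S) * card ?same_block)"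
    unfolding card_cartesian_product by (rule of_nat_mono)
  also have "\<dots> \<le> card A * (2 * real (card S) / g) * (card (block_pairs g) + c * card points)"
    unfolding of_nat_mult
    by (intro mult_mono same_block card_block_index_image_le assms mult_nonneg_nonneg) auto
  finally show ?thesis by simp
qed

lemma card_block_pairs_ge:
  fixes \<tau> L :: real
  assumes "A \<noteq> {}" "0 < \<tau>" "1 \<le> L" and fibre: "\<And>l. l \<in> S \<Longrightarrow> card (dilation_part A l) \<le> 2 * \<tau>"
    and dense: "card A * \<tau> * card S \<le> L * card points" and g_bounds: "8 * L \<le> g" "g \<le> card S"
  shows "real (card A) * card S * \<tau>\<^sup>2 * g / (4 * L\<^sup>2) \<le> card (block_pairs g)"
proof -
  define n V \<sigma> T where "n = real (card A)" and "V = real (card points)" and "\<sigma> = real (card S)"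
    and "T = real (card (block_pairs g))"
  note defs = this
  have "0 < g" using assms(3) g_bounds(1) by (cases g) auto
  then have pos: "0 < n" "0 < real g" "0 < \<sigma>"
    using g_bounds(2) assms(1) finite_A finite_S by (auto simp: defs card_gt_0_iff)
  have V_large: "n * \<tau> * \<sigma> \<le> L * V" using dense by (simp add: defs)
  have "V\<^sup>2 \<le> n * (2 * \<sigma> / g) * (T + 2 * \<tau> * V)"
    unfolding defs by (rule card_points_squared_le[OF \<open>0 < g\<close> g_bounds(2) fibre])
  then have "V\<^sup>2 * g \<le> 2 * n * \<sigma> * T + 4 * V * (n * \<tau> * \<sigma>)"
    using pos by (simp add: field_simps)
  moreover have "4 * V * (n * \<tau> * \<sigma>) \<le> V\<^sup>2 * g / 2"
  proof -
    have "4 * V * (n * \<tau> * \<sigma>) \<le> 4 * V * (L * V)"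
      using V_large by (intro mult_left_mono) (simp_all add: defs)
    also have "\<dots> = V\<^sup>2 * (8 * L) / 2" by (simp add: power2_eq_square)
    also have "\<dots> \<le> V\<^sup>2 * g / 2" by (intro divide_right_mono mult_left_mono g_bounds(1)) auto
    finally show ?thesis .
  qed
  ultimately have "V\<^sup>2 * g \<le> 4 * n * \<sigma> * T" by linarith
  have "(n * \<tau> * \<sigma>)\<^sup>2 * g \<le> (L * V)\<^sup>2 * g"
    using V_large pos assms(2) by (intro mult_right_mono power_mono) auto
  also have "\<dots> = L\<^sup>2 * (V\<^sup>2 * g)" by (simp add: power_mult_distrib)
  also have "\<dots> \<le> L\<^sup>2 * (4 * n * \<sigma> * T)"
    by (rule mult_left_mono[OF \<open>V\<^sup>2 * g \<le> 4 * n * \<sigma> * T\<close>]) simp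
  finally have "(n * \<sigma>) * (n * \<sigma> * \<tau>\<^sup>2 * g) \<le> (n * \<sigma>) * (4 * L\<^sup>2 * T)"
    by (simp add: power2_eq_square mult_ac)
  then have "n * \<sigma> * \<tau>\<^sup>2 * g \<le> 4 * L\<^sup>2 * T" using pos by simp
  then show ?thesis using assms(3) by (simp add: defs field_simps)
qed

lemma block_pairsE:
  assumes "z \<in> block_pairs g"
  obtains l m a p q where "z = ((l, a, p), (m, a, q))" "(l, a, p) \<in> points" "(m, a, q) \<in> points"
    "l \<noteq> m" "block_index S g l = block_index S g m"
  using assms unfolding block_pairs_def by blast

lemma block_pairs_swap: "prod.swap z \<in> block_pairs g \<longleftrightarrow> z \<in> block_pairs g"
  by (auto simp: block_pairs_def)

lemma pair_sum_swap: "z \<in> block_pairs g \<Longrightarrow> pair_sum (prod.swap z) = pair_sum z"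
  by (auto simp: block_pairs_def pair_sum_def)

lemma pair_sum_image_subset: "pair_sum ` block_pairs g \<subseteq> A \<times> sumset A \<times> sumset A"
proof (rule image_subsetI)
  fix z assume "z \<in> block_pairs g"
  then obtain l m a p q where z_pair: "z = ((l, a, p), (m, a, q))" "(l, a, p) \<in> points" "(m, a, q) \<in> points"
    by (rule block_pairsE)
  then have "p + q \<in> sumset A" "l * p + m * q \<in> sumset A"
    using pointsD(4,5) unfolding sumset_def by blast+
  then show "pair_sum z \<in> A \<times> sumset A \<times> sumset A"
    using pointsD(3)[OF z_pair(2)] by (simp add: z_pair(1) pair_sum_def)
qed

text \<open>The slope of a sum is a weighted mean of the two slopes, so the sum determines their common block.\<close>

lemma collision_same_block:
  assumes "(((l\<^sub>1, a, p\<^sub>1), y), ((l\<^sub>3, b, p\<^sub>3), y')) \<in> collisions pair_sum (block_pairs g)"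
  shows "block_index S g l\<^sub>1 = block_index S g l\<^sub>3"
proof -
  have block: "block_index S g (snd (snd (pair_sum z)) / fst (snd (pair_sum z))) = block_index S g (fst (fst z))"
    if "z \<in> block_pairs g" for z
  proof -
    from that obtain l m a p q where z_pair: "z = ((l, a, p), (m, a, q))" "(l, a, p) \<in> points" "(m, a, q) \<in> points"
      "block_index S g l = block_index S g m" by (rule block_pairsE)
    have "0 < p" "0 < q" using z_pair(2,3) by (auto dest: pointsD(7))
    then show ?thesis using block_index_weighted_mean[OF finite_S _ _ z_pair(4)] by (simp add: z_pair(1) pair_sum_def)
  qed
  show ?thesis
    using assms block[of "((l\<^sub>1, a, p\<^sub>1), y)"] block[of "((l\<^sub>3, b, p\<^sub>3), y')"] by (simp add: collisions_def)
qed

lemma collisions_subset_genuine: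
  "collisions pair_sum (block_pairs g) \<subseteq>
     (\<lambda>z. (z, z)) ` block_pairs g \<union> (\<lambda>z. (z, prod.swap z)) ` block_pairs g \<union>
     genuine_collisions g \<union> map_prod id prod.swap ` genuine_collisions g" (is "_ \<subseteq> ?rhs")
proof
  fix w assume w_coll: "w \<in> collisions pair_sum (block_pairs g)"
  then obtain z z' where zz': "w = (z, z')" "z \<in> block_pairs g" "z' \<in> block_pairs g" "pair_sum z = pair_sum z'"
    by (auto simp: collisions_def)
  obtain l\<^sub>1 l\<^sub>2 a p\<^sub>1 p\<^sub>2 where z_pair: "z = ((l\<^sub>1, a, p\<^sub>1), (l\<^sub>2, a, p\<^sub>2))" "l\<^sub>1 \<noteq> l\<^sub>2"
    using zz'(2) by (rule block_pairsE)
  obtain l\<^sub>3 l\<^sub>4 b p\<^sub>3 p\<^sub>4 where z'_pair: "z' = ((l\<^sub>3, b, p\<^sub>3), (l\<^sub>4, b, p\<^sub>4))" "l\<^sub>3 \<noteq> l\<^sub>4"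
    using zz'(3) by (rule block_pairsE)
  have eqs: "a = b" "p\<^sub>1 + p\<^sub>2 = p\<^sub>3 + p\<^sub>4" "l\<^sub>1 * p\<^sub>1 + l\<^sub>2 * p\<^sub>2 = l\<^sub>3 * p\<^sub>3 + l\<^sub>4 * p\<^sub>4"
    using zz'(4) by (simp_all add: z_pair z'_pair pair_sum_def)
  have "(z, prod.swap z') \<in> collisions pair_sum (block_pairs g)"
    using zz' by (simp add: collisions_def block_pairs_swap pair_sum_swap)
  consider (fourth_new) "l\<^sub>4 \<notin> {l\<^sub>1, l\<^sub>2}" | (third_new) "l\<^sub>3 \<notin> {l\<^sub>1, l\<^sub>2}"
    | (equal) "l\<^sub>3 = l\<^sub>1" "l\<^sub>4 = l\<^sub>2" | (swapped) "l\<^sub>3 = l\<^sub>2" "l\<^sub>4 = l\<^sub>1"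
    using z'_pair(2) by blast
  then show "w \<in> ?rhs"
  proof cases
    case fourth_new
    then have "w \<in> genuine_collisions g"
      using w_coll by (simp add: genuine_collisions_def zz'(1) z_pair z'_pair)
    then show ?thesis by blast
  next
    case third_new
    then have "(z, prod.swap z') \<in> genuine_collisions g"
      using \<open>(z, prod.swap z') \<in> _\<close> by (simp add: genuine_collisions_def z_pair z'_pair)
    then have "w \<in> map_prod id prod.swap ` genuine_collisions g"
      by (rule rev_image_eqI) (simp add: zz'(1))
    then show ?thesis by blast
  next
    case equal
    then have "w = (z, z)"
      using two_ray_decomposition_unique[OF z_pair(2), of p\<^sub>1 p\<^sub>2 p\<^sub>3 p\<^sub>4] eqs by (simp add: zz'(1) z_pair z'_pair)
    then show ?thesis using zz'(2) by blast
  next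
    case swapped
    then have "w = (z, prod.swap z)"
      using two_ray_decomposition_unique[OF z_pair(2), of p\<^sub>1 p\<^sub>2 p\<^sub>4 p\<^sub>3] eqs by (simp add: zz'(1) z_pair z'_pair add.commute)
    then show ?thesis using zz'(2) by blast
  qed
qed

lemma genuine_collisions_subset: "genuine_collisions g \<subseteq> collisions pair_sum (block_pairs g)"
  by (auto simp: genuine_collisions_def)

lemma finite_genuine_collisions [simp]: "finite (genuine_collisions g)"
  by (rule finite_subset[OF genuine_collisions_subset]) simp

lemma card_collisions_pair_sum_le:
  "card (collisions pair_sum (block_pairs g)) \<le> 2 * card (block_pairs g) + 2 * card (genuine_collisions g)"
proof -
  let ?\<Omega> = "block_pairs g" and ?E = "genuine_collisions g"
  have "card (collisions pair_sum ?\<Omega>)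
      \<le> card ((\<lambda>z. (z, z)) ` ?\<Omega> \<union> (\<lambda>z. (z, prod.swap z)) ` ?\<Omega> \<union> ?E \<union> map_prod id prod.swap ` ?E)"
    by (rule card_mono[OF _ collisions_subset_genuine]) simp
  also have "\<dots> \<le> card ((\<lambda>z. (z, z)) ` ?\<Omega>) + card ((\<lambda>z. (z, prod.swap z)) ` ?\<Omega>) + card ?E
      + card (map_prod id prod.swap ` ?E)"
    by (intro order_trans[OF card_Un_le] add_right_mono order.refl)
  also have "\<dots> \<le> card ?\<Omega> + card ?\<Omega> + card ?E + card ?E"
    by (intro add_mono card_image_le) simp_all
  finally show ?thesis by simp
qed

lemma finite_block_quadruples [simp]: "finite (block_quadruples g)"
  by (rule finite_subset[of _ "S \<times> S \<times> S \<times> S"]) (use finite_S in \<open>auto simp: block_quadruples_def\<close>)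

lemma card_block_quadruples_le:
  assumes "0 < g"
  shows "card (block_quadruples g) \<le> card S * g ^ 3"
proof -
  let ?block = "\<lambda>l. {m\<in>S. block_index S g m = block_index S g l}"
  have "card (block_quadruples g) \<le> card (SIGMA l:S. ?block l \<times> ?block l \<times> ?block l)"
    by (rule card_mono) (use finite_S in \<open>auto simp: block_quadruples_def\<close>)
  also have "\<dots> = (\<Sum>l\<in>S. card (?block l) * (card (?block l) * card (?block l)))"
    using finite_S by (simp add: card_cartesian_product)
  also have "\<dots> \<le> (\<Sum>l\<in>S. g * (g * g))"
    by (intro sum_mono mult_mono card_block_index_fibre_le finite_S assms) auto
  finally show ?thesis by (simp add: power3_eq_cube)
qed

lemma solutions_subset:
  assumes "\<theta> \<in> block_quadruples g"
  shows "solutions \<theta> \<subseteq> A \<times> A \<times> A \<times> A"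
  using assms G_subset dilation_part_subset by (fastforce simp: block_quadruples_def solutions_def)

lemma finite_solutions: "\<theta> \<in> block_quadruples g \<Longrightarrow> finite (solutions \<theta>)"
  by (rule finite_subset[OF solutions_subset]) (use finite_A in auto)

lemma card_genuine_collisions_le:
  "card (genuine_collisions g) \<le> (\<Sum>\<theta>\<in>block_quadruples g. card (solutions \<theta>))"
proof -
  let ?F = "\<lambda>(((l\<^sub>1, a, p\<^sub>1), (l\<^sub>2, a\<^sub>2, p\<^sub>2)), ((l\<^sub>3, a\<^sub>3, p\<^sub>3), (l\<^sub>4, a\<^sub>4, p\<^sub>4))).
    ((l\<^sub>1, l\<^sub>2, l\<^sub>3, l\<^sub>4), (a, p\<^sub>1, p\<^sub>2, p\<^sub>3))"
  have "card (genuine_collisions g) \<le> card (Sigma (block_quadruples g) solutions)"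
  proof (rule card_inj_on_le[of ?F])
    show "inj_on ?F (genuine_collisions g)"
      by (rule inj_onI) (clarsimp simp: genuine_collisions_def collisions_def block_pairs_def pair_sum_def)
    show "?F ` genuine_collisions g \<subseteq> Sigma (block_quadruples g) solutions"
    proof (rule image_subsetI)
      fix w assume w_genuine: "w \<in> genuine_collisions g"
      then have "w \<in> collisions pair_sum (block_pairs g)" using genuine_collisions_subset by blast
      then obtain z z' where zz': "w = (z, z')" "z \<in> block_pairs g" "z' \<in> block_pairs g" "pair_sum z = pair_sum z'"
        by (auto simp: collisions_def)
      obtain l\<^sub>1 l\<^sub>2 a p\<^sub>1 p\<^sub>2 where z_pair: "z = ((l\<^sub>1, a, p\<^sub>1), (l\<^sub>2, a, p\<^sub>2))"
        "(l\<^sub>1, a, p\<^sub>1) \<in> points" "(l\<^sub>2, a, p\<^sub>2) \<in> points" "block_index S g l\<^sub>1 = block_index S g l\<^sub>2"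
        using zz'(2) by (rule block_pairsE)
      obtain l\<^sub>3 l\<^sub>4 b p\<^sub>3 p\<^sub>4 where z'_pair: "z' = ((l\<^sub>3, b, p\<^sub>3), (l\<^sub>4, b, p\<^sub>4))"
        "(l\<^sub>3, b, p\<^sub>3) \<in> points" "(l\<^sub>4, b, p\<^sub>4) \<in> points" "l\<^sub>3 \<noteq> l\<^sub>4" "block_index S g l\<^sub>3 = block_index S g l\<^sub>4"
        using zz'(3) by (rule block_pairsE)
      have eqs: "a = b" "p\<^sub>1 + p\<^sub>2 = p\<^sub>3 + p\<^sub>4" "l\<^sub>1 * p\<^sub>1 + l\<^sub>2 * p\<^sub>2 = l\<^sub>3 * p\<^sub>3 + l\<^sub>4 * p\<^sub>4"
        using zz'(4) by (simp_all add: z_pair(1) z'_pair(1) pair_sum_def)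
      have "block_index S g l\<^sub>1 = block_index S g l\<^sub>3"
        using \<open>w \<in> collisions _ _\<close> unfolding zz'(1) z_pair(1) z'_pair(1) by (rule collision_same_block)
      moreover have "l\<^sub>4 \<notin> {l\<^sub>1, l\<^sub>2}" using w_genuine by (simp add: genuine_collisions_def zz'(1) z_pair(1) z'_pair(1))
      moreover have "(l\<^sub>1 - l\<^sub>4) * p\<^sub>1 + (l\<^sub>2 - l\<^sub>4) * p\<^sub>2 = (l\<^sub>3 - l\<^sub>4) * p\<^sub>3" using eqs(2,3) by algebra
      ultimately show "?F w \<in> Sigma (block_quadruples g) solutions"
        using z_pair z'_pair eqs(1) pointsD(1,2) by (simp add: zz'(1) block_quadruples_def solutions_def)
    qed
  qed (simp add: finite_solutions)
  then show ?thesis by (simp add: finite_solutions)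
qed

text \<open>The hypothesis says that the pairs outnumber their possible sums, in \<open>A \<times> (A + A) \<times> (A + A)\<close>, fourfold.\<close>

lemma card_block_pairs_le_genuine:
  assumes "4 * real (card A) * (real (card (sumset A)))\<^sup>2 \<le> card (block_pairs g)"
  shows "card (block_pairs g) \<le> card (genuine_collisions g)"
proof (cases "block_pairs g = {}")
  case False
  define T where "T = real (card (block_pairs g))"
  have T_pos: "0 < T" using False by (simp add: T_def card_gt_0_iff)
  have "(card (block_pairs g))\<^sup>2 \<le> card (A \<times> sumset A \<times> sumset A) * card (collisions pair_sum (block_pairs g))"
    by (rule card_squared_le_card_collisions[OF _ _ pair_sum_image_subset]) (use finite_A in auto)
  also have "\<dots> \<le> card (A \<times> sumset A \<times> sumset A) * (2 * card (block_pairs g) + 2 * card (genuine_collisions g))"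
    by (rule mult_le_mono2[OF card_collisions_pair_sum_le])
  finally have "real ((card (block_pairs g))\<^sup>2)
      \<le> real (card (A \<times> sumset A \<times> sumset A) * (2 * card (block_pairs g) + 2 * card (genuine_collisions g)))"
    by (rule of_nat_mono)
  then have "4 * T\<^sup>2 \<le> (4 * real (card A) * (real (card (sumset A)))\<^sup>2) * (2 * T + 2 * card (genuine_collisions g))"
    by (simp add: T_def card_cartesian_product power2_eq_square)
  also have "\<dots> \<le> T * (2 * T + 2 * card (genuine_collisions g))"
    using assms by (intro mult_right_mono) (auto simp: T_def)
  finally have "T * (4 * T) \<le> T * (2 * T + 2 * card (genuine_collisions g))" by (simp add: power2_eq_square)
  then show ?thesis using T_pos by (simp add: T_def)
qed simp

lemma exists_rich_block_quadruple:
  fixes \<tau> L :: real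
  assumes "A \<noteq> {}" "0 < \<tau>" "1 \<le> L" and fibre: "\<And>l. l \<in> S \<Longrightarrow> card (dilation_part A l) \<le> 2 * \<tau>"
    and dense: "card A * \<tau> * card S \<le> L * card points" and g_bounds: "8 * L \<le> g" "g \<le> card S"
    and g_sumset: "16 * L\<^sup>2 * (real (card (sumset A)))\<^sup>2 \<le> card S * \<tau>\<^sup>2 * g"
  obtains \<theta> where "\<theta> \<in> block_quadruples g" "card A * \<tau>\<^sup>2 \<le> 4 * L\<^sup>2 * (real g)\<^sup>2 * card (solutions \<theta>)"
proof -
  define n \<sigma> where "n = real (card A)" and "\<sigma> = real (card S)"
  have "0 < g" using assms(3) g_bounds(1) by (cases g) auto
  then have pos: "0 < n" "0 < real g" "0 < \<sigma>"
    using g_bounds(2) assms(1) finite_A finite_S by (auto simp: n_def \<sigma>_def card_gt_0_iff)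
  have pairs: "n * \<sigma> * \<tau>\<^sup>2 * g / (4 * L\<^sup>2) \<le> card (block_pairs g)"
    unfolding n_def \<sigma>_def by (rule card_block_pairs_ge) (use assms in auto)
  have "n * (16 * L\<^sup>2 * (real (card (sumset A)))\<^sup>2) \<le> n * (\<sigma> * \<tau>\<^sup>2 * g)"
    using g_sumset pos by (intro mult_left_mono) (auto simp: \<sigma>_def)
  then have "4 * n * (real (card (sumset A)))\<^sup>2 \<le> n * \<sigma> * \<tau>\<^sup>2 * g / (4 * L\<^sup>2)"
    using assms(3) by (simp add: field_simps)
  then have "card (block_pairs g) \<le> card (genuine_collisions g)"
    using pairs by (intro card_block_pairs_le_genuine) (simp add: n_def)
  also have "\<dots> \<le> (\<Sum>\<theta>\<in>block_quadruples g. card (solutions \<theta>))" by (rule card_genuine_collisions_le)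
  finally have "real (card (block_pairs g)) \<le> real (\<Sum>\<theta>\<in>block_quadruples g. card (solutions \<theta>))" by (rule of_nat_mono)
  with pairs have total: "n * \<sigma> * \<tau>\<^sup>2 * g / (4 * L\<^sup>2) \<le> (\<Sum>\<theta>\<in>block_quadruples g. real (card (solutions \<theta>)))" by simp
  have "real (card (block_quadruples g)) \<le> real (card S * g ^ 3)"
    using card_block_quadruples_le[OF \<open>0 < g\<close>] by (rule of_nat_mono)
  then have "card (block_quadruples g) * (n * \<tau>\<^sup>2 / (4 * L\<^sup>2 * (real g)\<^sup>2))
      \<le> (\<sigma> * real g ^ 3) * (n * \<tau>\<^sup>2 / (4 * L\<^sup>2 * (real g)\<^sup>2))"
    using pos by (intro mult_right_mono) (auto simp: \<sigma>_def)
  also have "\<dots> = n * \<sigma> * \<tau>\<^sup>2 * g / (4 * L\<^sup>2)"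
    using pos by (simp add: power3_eq_cube power2_eq_square)
  also note total
  finally have average: "card (block_quadruples g) * (n * \<tau>\<^sup>2 / (4 * L\<^sup>2 * (real g)\<^sup>2))
      \<le> (\<Sum>\<theta>\<in>block_quadruples g. real (card (solutions \<theta>)))" .
  have "0 < n * \<sigma> * \<tau>\<^sup>2 * g / (4 * L\<^sup>2)" using pos assms(2,3) by simp
  with total have "block_quadruples g \<noteq> {}" by auto
  then obtain \<theta> where "\<theta> \<in> block_quadruples g" "n * \<tau>\<^sup>2 / (4 * L\<^sup>2 * (real g)\<^sup>2) \<le> card (solutions \<theta>)"
    using exists_ge_average[OF finite_block_quadruples _ average] by blast
  moreover have "0 < 4 * L\<^sup>2 * (real g)\<^sup>2" using pos assms(3) by simp
  ultimately show thesis using that by (simp add: n_def pos_divide_le_eq mult.commute)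
qed

end

subsection \<open>Dilated solutions\<close>

text \<open>A dilate \<open>(a p, a r)\<close> determines \<open>r / p\<close>, so a collision of dilates is a coincidence of ratios.\<close>

lemma card_dilate_collisions_le:
  fixes A P R :: "'a::field set"
  assumes "finite A" "finite P" "finite R" "0 \<notin> A" "0 \<notin> P" "V \<subseteq> A \<times> P \<times> R"
  shows "card (collisions (\<lambda>(a, p, r). (a * p, a * r)) V) \<le> card A * multiplicative_energy P R"
proof -
  let ?ratio = "\<lambda>(p, r). r / p :: 'a"
  let ?F = "\<lambda>((a, x), (a', x')). (a, x, x') :: 'a \<times> ('a \<times> 'a) \<times> ('a \<times> 'a)"
  have "card (collisions (\<lambda>(a, p, r). (a * p, a * r)) V) \<le> card (A \<times> collisions ?ratio (P \<times> R))"
  proof (rule card_inj_on_le[of ?F])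
    show "inj_on ?F (collisions (\<lambda>(a, p, r). (a * p, a * r)) V)"
      using assms(5,6) by (force simp: inj_on_def collisions_def)
    have "r / p = r' / p'"
      if "a * p = a' * p'" "a * r = a' * r'" "a \<in> A" "a' \<in> A" "p \<in> P" "p' \<in> P" for a a' p p' r r'
    proof -
      have nonzero: "a \<noteq> 0" "a' \<noteq> 0" "p \<noteq> 0" "p' \<noteq> 0" using that assms(4,5) by auto
      have "r / p = (a * r) / (a * p)" using nonzero by simp
      also have "\<dots> = r' / p'" unfolding that(1,2) using nonzero by simp
      finally show ?thesis .
    qed
    then show "?F ` collisions (\<lambda>(a, p, r). (a * p, a * r)) V \<subseteq> A \<times> collisions ?ratio (P \<times> R)"
      using assms(6) by (fastforce simp: collisions_def)
  qed (use assms in simp)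
  then show ?thesis by (simp add: multiplicative_energy_def card_cartesian_product)
qed

lemma card_solution_fibres_le:
  fixes A P Q R :: "'a::ab_group_add set"
  assumes fin: "finite A" "finite Q" and W_subset: "W \<subseteq> A \<times> P \<times> R" and difference: "\<And>a p r. (a, p, r) \<in> W \<Longrightarrow> r - p \<in> Q"
  shows "card {x\<in>W. (fst \<circ> snd) x = p} \<le> card A * card {q\<in>Q. p + q \<in> R}"
    and "card {x\<in>W. (snd \<circ> snd) x = r} \<le> card A * card {q\<in>Q. r - q \<in> P}"
proof -
  let ?F = "\<lambda>(a, p, r). (a, r - p) :: 'a \<times> 'a"
  have "card {x\<in>W. (fst \<circ> snd) x = p} \<le> card (A \<times> {q\<in>Q. p + q \<in> R})"
    by (rule card_inj_on_le[of ?F]) (use W_subset difference fin in \<open>auto simp: inj_on_def\<close>)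
  then show "card {x\<in>W. (fst \<circ> snd) x = p} \<le> card A * card {q\<in>Q. p + q \<in> R}"
    by (simp add: card_cartesian_product)
  have "card {x\<in>W. (snd \<circ> snd) x = r} \<le> card (A \<times> {q\<in>Q. r - q \<in> P})"
    by (rule card_inj_on_le[of ?F]) (use W_subset difference fin in \<open>auto simp: inj_on_def\<close>)
  then show "card {x\<in>W. (snd \<circ> snd) x = r} \<le> card A * card {q\<in>Q. r - q \<in> P}"
    by (simp add: card_cartesian_product)
qed

lemma exists_popular_sums:
  fixes A P Q R :: "'a::linordered_field set" and t :: real
  assumes fin: "finite A" "finite P" "finite Q" "finite R" and "W \<noteq> {}"
    and W_subset: "W \<subseteq> A \<times> P \<times> R" and difference: "\<And>a p r. (a, p, r) \<in> W \<Longrightarrow> r - p \<in> Q"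
    and t_bounds: "card P \<le> t" "card Q \<le> t" "card R \<le> t" "1 \<le> t"
  obtains V where "V \<subseteq> W" "card W / 2 \<le> card V"
    "popular_sums P Q R ((fst \<circ> snd) ` V) ((snd \<circ> snd) ` V) t (card W / (4 * t * card A))"
proof -
  have finW: "finite W" by (rule finite_subset[OF W_subset]) (use fin in simp)
  have "A \<noteq> {}" using \<open>W \<noteq> {}\<close> W_subset by auto
  then have pos: "0 < real (card A)" "0 < real (card W)" "0 < t"
    using \<open>W \<noteq> {}\<close> finW fin t_bounds by (simp_all add: card_gt_0_iff)
  have images: "(fst \<circ> snd) ` W \<subseteq> P" "(snd \<circ> snd) ` W \<subseteq> R" using W_subset by auto
  obtain V where V_large: "V \<subseteq> W" "card W / 2 \<le> card V"
    and rich_p: "\<And>v. v \<in> V \<Longrightarrow> card W / (4 * t) \<le> card {x\<in>W. (fst \<circ> snd) x = (fst \<circ> snd) v}"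
    and rich_r: "\<And>v. v \<in> V \<Longrightarrow> card W / (4 * t) \<le> card {x\<in>W. (snd \<circ> snd) x = (snd \<circ> snd) v}"
    by (rule exists_subset_with_rich_fibres[OF finW pos(3) fin(2) images(1) t_bounds(1) fin(4) images(2) t_bounds(3)]) auto
  have d_le: "card W / (4 * t * card A) \<le> card Y"
    if "card W / (4 * t) \<le> card X" "card X \<le> card A * card Y" for X :: "('a \<times> 'a \<times> 'a) set" and Y :: "'a set"
  proof -
    have "card W / (4 * t) \<le> real (card A * card Y)" using that by linarith
    then show ?thesis using pos by (simp add: field_simps)
  qed
  have "popular_sums P Q R ((fst \<circ> snd) ` V) ((snd \<circ> snd) ` V) t (card W / (4 * t * card A))"
  proof
    show "(fst \<circ> snd) ` V \<subseteq> P" "(snd \<circ> snd) ` V \<subseteq> R" using images V_large(1) by blast+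
    show "card W / (4 * t * card A) \<le> card {q\<in>Q. p + q \<in> R}" if "p \<in> (fst \<circ> snd) ` V" for p
    proof (rule d_le[OF _ card_solution_fibres_le(1)[OF fin(1,3) W_subset difference]])
      obtain v where "v \<in> V" "p = (fst \<circ> snd) v" using \<open>p \<in> _\<close> by blast
      then show "card W / (4 * t) \<le> card {x\<in>W. (fst \<circ> snd) x = p}" using rich_p by blast
    qed
    show "card W / (4 * t * card A) \<le> card {q\<in>Q. r - q \<in> P}" if "r \<in> (snd \<circ> snd) ` V" for r
    proof (rule d_le[OF _ card_solution_fibres_le(2)[OF fin(1,3) W_subset difference]])
      obtain v where "v \<in> V" "r = (snd \<circ> snd) v" using \<open>r \<in> _\<close> by blast
      then show "card W / (4 * t) \<le> card {x\<in>W. (snd \<circ> snd) x = r}" using rich_r by blast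
    qed
  qed (use fin t_bounds pos in auto)
  with V_large show thesis by (rule that)
qed

lemma card_dilates_ge:
  fixes A P Q R :: "'a::linordered_field set" and W :: "('a \<times> 'a \<times> 'a) set" and t :: real
  assumes fin: "finite A" "finite P" "finite Q" "finite R" and nonzero: "0 \<notin> A" "0 \<notin> P" "0 \<notin> R"
    and W_subset: "W \<subseteq> A \<times> P \<times> R" and difference: "\<And>a p r. (a, p, r) \<in> W \<Longrightarrow> r - p \<in> Q"
    and t_bounds: "card P \<le> t" "card Q \<le> t" "card R \<le> t" "1 \<le> t" "t < 2 ^ k"
  shows "real (card W) ^ 6
    \<le> 4210688 * real k * real (card A) ^ 5 * t ^ 10 * card ((\<lambda>(a, p, r). (a * p, a * r)) ` W)"
proof (cases "W = {}")
  case False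
  let ?D = "\<lambda>(a, p, r). (a * p, a * r) :: 'a \<times> 'a"
  define n w where "n = real (card A)" and "w = real (card W)"
  define d where "d = w / (4 * t * n)"
  obtain V where V_large: "V \<subseteq> W" "w / 2 \<le> card V"
    and sums: "popular_sums P Q R ((fst \<circ> snd) ` V) ((snd \<circ> snd) ` V) t d"
    by (rule exists_popular_sums[OF fin False W_subset difference t_bounds(1-4), folded n_def w_def, folded d_def])
  define P' R' where "P' = (fst \<circ> snd) ` V" and "R' = (snd \<circ> snd) ` V"
  interpret popular_sums P Q R P' R' t d using sums by (simp only: P'_def R'_def)
  have finW: "finite W" by (rule finite_subset[OF W_subset]) (use fin in simp)
  have pos: "0 < n" "0 < w" "0 < t"
    using d_pos t_bounds(4) by (auto simp: d_def n_def w_def zero_less_divide_iff zero_less_mult_iff)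
  have nonzero': "0 \<notin> P'" "0 \<notin> R'" using subset nonzero by auto
  have "V \<subseteq> A \<times> P' \<times> R'" using W_subset V_large(1) by (force simp: P'_def R'_def)
  then have "card (collisions ?D V) \<le> card A * multiplicative_energy P' R'"
    by (intro card_dilate_collisions_le) (use fin finite_popular nonzero nonzero' in auto)
  then have "real (card (collisions ?D V)) \<le> real (card A * multiplicative_energy P' R')" by (rule of_nat_mono)
  also have "\<dots> = n * multiplicative_energy P' R'" by (simp add: n_def)
  also have "\<dots> \<le> n * (4112 * real k * t ^ 6 / d ^ 4)"
    using pos by (intro mult_left_mono multiplicative_energy_le nonzero' t_bounds) auto
  finally have collisions_le: "card (collisions ?D V) \<le> n * (4112 * real k * t ^ 6 / d ^ 4)" .
  have "(w / 2)\<^sup>2 \<le> (real (card V))\<^sup>2" using V_large(2) pos by (intro power_mono) auto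
  also have "\<dots> \<le> real (card (?D ` W) * card (collisions ?D V))"
    unfolding of_nat_power[symmetric]
    by (intro of_nat_mono card_squared_le_card_collisions image_mono)
       (use finite_subset[OF V_large(1) finW] finW V_large(1) in simp_all)
  also have "\<dots> \<le> card (?D ` W) * (n * (4112 * real k * t ^ 6 / d ^ 4))"
    unfolding of_nat_mult by (intro mult_left_mono collisions_le) simp
  also have "\<dots> = 1052672 * real k * n ^ 5 * t ^ 10 * card (?D ` W) / w ^ 4"
    using pos by (simp add: d_def field_simps power_numeral_reduce)
  finally have "w\<^sup>2 / 4 * w ^ 4 \<le> 1052672 * real k * n ^ 5 * t ^ 10 * card (?D ` W)"
    using pos by (simp add: pos_le_divide_eq power_divide)
  then show ?thesis by (simp add: n_def w_def power_numeral_reduce mult_ac)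
qed simp

text \<open>Each \<open>(y, z)\<close> gives an incidence of the point \<open>(m (z - y), y)\<close> with the line \<open>y = z - x / m\<close>
  for every slope \<open>m\<close> with \<open>m (z - y) \<in> H\<close>.\<close>

lemma card_popular_differences_le:
  fixes S H Y Z :: "'a::linordered_field set" and T :: "('a \<times> 'a) set" and \<rho> :: real
  assumes fin: "finite S" "finite H" "finite Y" "finite Z" and "0 \<notin> S" and T_subset: "T \<subseteq> Y \<times> Z"
    and popular: "\<And>y z. (y, z) \<in> T \<Longrightarrow> \<rho> \<le> card {m\<in>S. m * (z - y) \<in> H}"
    and large: "8 * real (card S) * card Z \<le> card T * \<rho>"
  shows "(card T * \<rho>) ^ 3 \<le> 1024 * (real (card H) * card Y * (real (card S) * card Z))\<^sup>2"
proof -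
  define L where "L = (\<lambda>(m, z). (- inverse m, z)) ` (S \<times> Z)"
  have finL: "finite L" and finT: "finite T"
    using fin finite_subset[OF T_subset] by (auto simp: L_def)
  have "card L \<le> card (S \<times> Z)" unfolding L_def using fin by (intro card_image_le) auto
  then have card_L: "real (card L) \<le> real (card S) * card Z"
    by (simp add: card_cartesian_product flip: of_nat_mult)
  let ?Inc = "SIGMA (y, z):T. {m\<in>S. m * (z - y) \<in> H}"
  let ?F = "\<lambda>((y, z), m). ((- inverse m, z), m * (z - y))"
  have "card ?Inc \<le> card (SIGMA l:L. line_points H Y l)"
  proof (rule card_inj_on_le[of ?F])
    show "inj_on ?F ?Inc" using \<open>0 \<notin> S\<close> by (auto simp: inj_on_def)
    have "((- inverse m, z), m * (z - y)) \<in> (SIGMA l:L. line_points H Y l)"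
      if "(y, z) \<in> T" "m \<in> S" "m * (z - y) \<in> H" for y z m
    proof -
      have "m \<noteq> 0" using that(2) \<open>0 \<notin> S\<close> by auto
      then have "line_at (- inverse m, z) (m * (z - y)) = y" by (simp add: line_at_def field_simps)
      then show ?thesis using that T_subset by (auto simp: L_def line_points_def)
    qed
    then show "?F ` ?Inc \<subseteq> (SIGMA l:L. line_points H Y l)" by auto
  qed (use finL fin in simp)
  also have "\<dots> = (\<Sum>l\<in>L. card (line_points H Y l))" using finL fin by simp
  finally have "real (card ?Inc) \<le> (\<Sum>l\<in>L. real (card (line_points H Y l)))"
    unfolding of_nat_sum[symmetric] by (rule of_nat_mono)
  moreover have "card T * \<rho> \<le> (\<Sum>x\<in>T. real (card (case x of (y, z) \<Rightarrow> {m\<in>S. m * (z - y) \<in> H})))"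
    by (rule sum_bounded_below) (use popular in auto)
  moreover have "\<dots> = card ?Inc" using finT fin by (simp add: split_def)
  ultimately have incidences: "card T * \<rho> \<le> (\<Sum>l\<in>L. real (card (line_points H Y l)))" by linarith
  have "(card T * \<rho>) ^ 3 \<le> 1024 * (real (card H) * card Y * card L)\<^sup>2"
  proof (rule incidences_cubed_le[OF _ _ _ _ incidences])
    show "fst l \<noteq> 0" if "l \<in> L" for l using that \<open>0 \<notin> S\<close> by (auto simp: L_def)
    show "8 * real (card L) \<le> card T * \<rho>" using card_L large by linarith
  qed (use fin finL in auto)
  also have "\<dots> \<le> 1024 * (real (card H) * card Y * (real (card S) * card Z))\<^sup>2"
    using card_L by (intro mult_left_mono power_mono) auto
  finally show ?thesis .
qed

subsection \<open>Popular slopes and regular products\<close>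

lemma finite_prodset [simp]: "finite A \<Longrightarrow> finite (prodset A)"
  unfolding prodset_def by (rule finite_image_set2) auto

lemma prodsetI: "a \<in> A \<Longrightarrow> b \<in> A \<Longrightarrow> a * b \<in> prodset A"
  by (auto simp: prodset_def)

lemma card_prodset_pos: "finite A \<Longrightarrow> A \<noteq> {} \<Longrightarrow> 0 < card (prodset A)"
  by (auto simp: card_gt_0_iff dest: prodsetI)

lemma card_le_card_prodset:
  assumes "finite A" "0 \<notin> A"
  shows "card A \<le> card (prodset A)"
proof (cases "A = {}")
  case False
  then obtain b where "b \<in> A" by auto
  then show ?thesis
    using assms by (intro card_inj_on_le[of "(*) b"]) (auto simp: inj_on_def intro: prodsetI)
qed simp

lemma card_power4_le_multiplicative_energy:
  assumes "finite A" "0 \<notin> A"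
  shows "card A ^ 4 \<le> card (prodset A) * multiplicative_energy A A"
proof -
  let ?mult = "\<lambda>(a, b). a * b :: real" and ?ratio = "\<lambda>(a, b). b / a :: real"
  let ?F = "\<lambda>((a, b), (c, d)). ((c, a), (b, d)) :: (real \<times> real) \<times> (real \<times> real)"
  have "card (collisions ?mult (A \<times> A)) \<le> card (collisions ?ratio (A \<times> A))"
  proof (rule card_inj_on_le[of ?F])
    have "a / c = d / b" if "a * b = c * d" "b \<in> A" "c \<in> A" for a b c d
      using that assms(2) by (subst frac_eq_eq) (auto simp: mult.commute)
    then show "?F ` collisions ?mult (A \<times> A) \<subseteq> collisions ?ratio (A \<times> A)"
      by (auto simp: collisions_def)
  qed (use assms in \<open>auto simp: inj_on_def\<close>)
  moreover have "(card (A \<times> A))\<^sup>2 \<le> card (prodset A) * card (collisions ?mult (A \<times> A))"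
    by (rule card_squared_le_card_collisions) (use assms in \<open>auto intro: prodsetI\<close>)
  moreover have "(card (A \<times> A))\<^sup>2 = card A ^ 4"
    by (simp add: card_cartesian_product power_numeral_reduce)
  ultimately show ?thesis
    unfolding multiplicative_energy_def by (metis mult_le_mono2 order_trans)
qed

locale popular_slopes =
  fixes A S :: "real set" and \<tau> :: real
  assumes finite_A: "finite A" and A_nonempty: "A \<noteq> {}" and A_pos: "a \<in> A \<Longrightarrow> 0 < a"
    and finite_S: "finite S" and S_nonempty: "S \<noteq> {}" and zero_notin_S: "0 \<notin> S" and \<tau>_ge_1: "1 \<le> \<tau>"
    and card_dilation_part: "l \<in> S \<Longrightarrow> \<tau> \<le> card (dilation_part A l) \<and> card (dilation_part A l) \<le> 2 * \<tau>"
begin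

lemma card_S_mult_\<tau>_le: "card S * \<tau> \<le> (real (card A))\<^sup>2"
proof -
  have "card S * \<tau> \<le> (\<Sum>l\<in>S. real (card (dilation_part A l)))"
    by (rule sum_bounded_below) (use card_dilation_part in auto)
  also have "\<dots> = card (SIGMA l:S. dilation_part A l)" using finite_S finite_A by simp
  also have "\<dots> \<le> card (A \<times> A)"
    by (intro of_nat_mono card_inj_on_le[of "\<lambda>(l, a). (a, l * a)"])
       (use finite_A A_pos in \<open>force simp: inj_on_def dilation_part_def\<close>)+
  finally show ?thesis by (simp add: card_cartesian_product power2_eq_square)
qed

lemma card_product_fibre_le:
  "card {x \<in> A \<times> dilation_part A l. (\<lambda>(a, p). a * p) x = y} \<le> card (dilation_part A l)"
proof (rule card_inj_on_le[of snd])
  show "inj_on snd {x \<in> A \<times> dilation_part A l. (\<lambda>(a, p). a * p) x = y}"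
  proof (rule inj_onI)
    fix u v
    assume uv: "u \<in> {x \<in> A \<times> dilation_part A l. (\<lambda>(a, p). a * p) x = y}"
      "v \<in> {x \<in> A \<times> dilation_part A l. (\<lambda>(a, p). a * p) x = y}" "snd u = snd v"
    then have "snd v \<in> A" by (auto dest: subsetD[OF dilation_part_subset])
    then have "snd v \<noteq> 0" using A_pos by force
    moreover have "fst u * snd v = fst v * snd v" using uv by (auto simp: split_def)
    ultimately show "u = v" using uv(3) by (simp add: prod_eq_iff)
  qed
qed (use finite_A in auto)

lemma \<tau>_le_card_A: "\<tau> \<le> card A"
proof -
  obtain l where "l \<in> S" using S_nonempty by auto
  then have "\<tau> \<le> card (dilation_part A l)" using card_dilation_part by blast
  also have "\<dots> \<le> card A" by (intro of_nat_mono card_mono finite_A dilation_part_subset)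
  finally show ?thesis .
qed

end

lemma exists_popular_slopes:
  assumes "finite A" "A \<noteq> {}" and pos: "\<And>a. a \<in> A \<Longrightarrow> 0 < a" and card_less: "card A < 2 ^ k"
  obtains S and \<tau> :: real where "popular_slopes A S \<tau>"
    "real (card A) ^ 4 \<le> 4 * real k * card (prodset A) * (card S * \<tau>\<^sup>2)"
proof -
  define \<Lambda> where "\<Lambda> = (\<lambda>(a, b). b / a :: real) ` (A \<times> A)"
  define N where "N l = card (dilation_part A l)" for l
  have fin: "finite \<Lambda>" and nonzero: "0 \<notin> A" using assms(1) pos by (auto simp: \<Lambda>_def)
  have "0 < k" using card_less assms(1,2) by (cases k) (auto simp: card_gt_0_iff)
  have "N l \<le> card A" for l
    unfolding N_def by (rule card_mono[OF assms(1) dilation_part_subset])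
  then have N_less: "N l < 2 ^ k" for l using card_less by (rule le_less_trans)
  obtain j where level_sum: "(\<Sum>l\<in>\<Lambda>. (real (N l))\<^sup>2) \<le> k * (\<Sum>l\<in>{l\<in>\<Lambda>. floor_log (N l) = j}. (real (N l))\<^sup>2)"
    by (rule dyadic_pigeonhole[OF fin \<open>0 < k\<close> N_less])
  define S where "S = {l\<in>\<Lambda>. floor_log (N l) = j}"
  define \<tau> :: real where "\<tau> = 2 ^ j"
  have level: "\<tau> \<le> N l \<and> N l \<le> 2 * \<tau>" if "l \<in> S" for l
  proof -
    obtain a b where "a \<in> A" "b \<in> A" "l = b / a" using \<open>l \<in> S\<close> by (auto simp: S_def \<Lambda>_def)
    with nonzero have "a \<in> dilation_part A l" by (auto simp: dilation_part_def)
    then have "0 < N l" using assms(1) by (auto simp: N_def card_gt_0_iff)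
    then show ?thesis using floor_log_bounds[of "N l"] that by (simp add: S_def \<tau>_def)
  qed
  have "multiplicative_energy A A = (\<Sum>l\<in>\<Lambda>. (N l)\<^sup>2)"
    unfolding \<Lambda>_def N_def dilation_part_def
    by (rule multiplicative_energy_eq_sum_squares[OF assms(1,1) nonzero])
  then have "real (multiplicative_energy A A) \<le> k * (\<Sum>l\<in>S. (real (N l))\<^sup>2)"
    using level_sum by (simp add: S_def)
  also have "\<dots> \<le> k * (card S * (2 * \<tau>)\<^sup>2)"
    using level by (intro mult_left_mono sum_bounded_above power_mono) auto
  finally have energy: "multiplicative_energy A A \<le> 4 * real k * (card S * \<tau>\<^sup>2)"
    by (simp add: power_mult_distrib)
  have "real (card A ^ 4) \<le> real (card (prodset A) * multiplicative_energy A A)"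
    by (intro of_nat_mono card_power4_le_multiplicative_energy assms(1) nonzero)
  also have "\<dots> \<le> card (prodset A) * (4 * real k * (card S * \<tau>\<^sup>2))"
    unfolding of_nat_mult by (rule mult_left_mono[OF energy]) simp
  finally have bound: "real (card A) ^ 4 \<le> 4 * real k * card (prodset A) * (card S * \<tau>\<^sup>2)"
    by (simp add: mult_ac)
  have "0 < real (card A) ^ 4" using assms(1,2) by (simp add: card_gt_0_iff)
  with bound have "S \<noteq> {}" by auto
  moreover have "0 \<notin> S" using nonzero by (auto simp: S_def \<Lambda>_def)
  ultimately have "popular_slopes A S \<tau>"
    using assms fin level by unfold_locales (auto simp: S_def \<tau>_def N_def)
  then show thesis using bound by (rule that)
qed

text \<open>The products \<open>a p\<close> with \<open>(a, p) \<in> G l\<close> lie in a set \<open>Q l\<close> of products whose dilates by \<open>l\<close> are products again,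
  and each of them lies in \<open>Q m\<close> for many slopes \<open>m\<close>, however small the sets \<open>Q m\<close> are.\<close>

locale regular_products = popular_slopes A S \<tau> for A S :: "real set" and \<tau> :: real +
  fixes G :: "real \<Rightarrow> (real \<times> real) set" and Q :: "real \<Rightarrow> real set" and r :: real and k :: nat
  assumes r_pos: "0 < r" and k_pos: "0 < k" and \<tau>_less: "2 * \<tau> < 2 ^ k"
    and G_subset: "l \<in> S \<Longrightarrow> G l \<subseteq> A \<times> dilation_part A l"
    and Q_subset: "l \<in> S \<Longrightarrow> Q l \<subseteq> (\<lambda>(a, p). a * p) ` (A \<times> dilation_part A l)"
    and G_products: "l \<in> S \<Longrightarrow> (\<lambda>(a, p). a * p) ` G l \<subseteq> Q l"
    and card_Q: "l \<in> S \<Longrightarrow> r * card (Q l) \<le> 2 * card A * \<tau>"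
    and G_dense: "card A * \<tau> * card S \<le> 2 * real k * (\<Sum>l\<in>S. card (G l))"
    and popular: "l \<in> S \<Longrightarrow> (a, p) \<in> G l \<Longrightarrow>
      card A * \<tau> * card S \<le> 4 * real k * r * card (prodset A) * card {m\<in>S. a * p \<in> Q m}"

sublocale regular_products \<subseteq> ray_points
  by unfold_locales (use finite_A A_pos finite_S G_subset in auto)

lemma (in popular_slopes) exists_regular_products:
  assumes "0 < k" "2 * \<tau> < 2 ^ k"
  obtains G Q r where "regular_products A S \<tau> G Q r k"
proof -
  let ?X = "\<lambda>l. A \<times> dilation_part A l" and ?mult = "\<lambda>(a, p). a * p :: real"
  have fibre: "card {x'\<in>?X l. ?mult x' = ?mult x} < 2 ^ k" if "l \<in> S" "x \<in> ?X l" for l x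
  proof -
    have "card {x'\<in>?X l. ?mult x' = ?mult x} \<le> card (dilation_part A l)" by (rule card_product_fibre_le)
    then have "real (card {x'\<in>?X l. ?mult x' = ?mult x}) < 2 ^ k"
      using card_dilation_part[OF that(1)] assms(2) by linarith
    then show ?thesis by simp
  qed
  have products: "?mult ` ?X l \<subseteq> prodset A" for l
    by (auto simp: dilation_part_def intro: prodsetI)
  obtain r :: real and Q G where G_products: "\<And>l. l \<in> S \<Longrightarrow> G l \<subseteq> ?X l" "\<And>l. l \<in> S \<Longrightarrow> ?mult ` G l \<subseteq> Q l"
    and Q_products: "\<And>l. l \<in> S \<Longrightarrow> Q l \<subseteq> ?mult ` ?X l" "\<And>l. l \<in> S \<Longrightarrow> r * card (Q l) \<le> card (?X l)"
    and dense: "real (\<Sum>l\<in>S. card (?X l)) \<le> 2 * real k * (\<Sum>l\<in>S. card (G l))"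
    and r_pos: "0 < r"
    and popular: "\<And>l x. l \<in> S \<Longrightarrow> x \<in> G l \<Longrightarrow>
      real (\<Sum>l\<in>S. card (?X l)) \<le> 4 * real k * r * card (prodset A) * card {m\<in>S. ?mult x \<in> Q m}"
    by (rule exists_regular_popular_subfamily[of S ?X "prodset A" k ?mult])
       (use finite_S finite_A assms(1) products fibre in auto)
  have "card S * (card A * \<tau>) \<le> (\<Sum>l\<in>S. real (card (?X l)))"
    by (rule sum_bounded_below) (use card_dilation_part in \<open>simp add: card_cartesian_product mult_left_mono\<close>)
  then have total: "card A * \<tau> * card S \<le> real (\<Sum>l\<in>S. card (?X l))" by (simp add: mult_ac)
  have card_Q: "r * card (Q l) \<le> 2 * card A * \<tau>" if "l \<in> S" for l
  proof -
    have "real (card A) * card (dilation_part A l) \<le> card A * (2 * \<tau>)"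
      using card_dilation_part[OF that] by (intro mult_left_mono) auto
    then show ?thesis using Q_products(2)[OF that] by (simp add: card_cartesian_product)
  qed
  have "regular_products A S \<tau> G Q r k"
  proof
    show "card A * \<tau> * card S \<le> 2 * real k * (\<Sum>l\<in>S. card (G l))"
      using total dense by linarith
    show "card A * \<tau> * card S \<le> 4 * real k * r * card (prodset A) * card {m\<in>S. a * p \<in> Q m}"
      if "l \<in> S" "(a, p) \<in> G l" for l a p
      using total popular[OF that] by simp
  qed (use assms r_pos G_products Q_products(1) card_Q in simp_all)
  then show thesis by (rule that)
qed

lemma (in ray_points) inj_on_scaled_solutions:
  assumes "l\<^sub>4 \<notin> {l\<^sub>1, l\<^sub>2, l\<^sub>3}"
  shows "inj_on (\<lambda>(a, p\<^sub>1, p\<^sub>2, p\<^sub>3). (a, (l\<^sub>1 - l\<^sub>4) * p\<^sub>1, (l\<^sub>3 - l\<^sub>4) * p\<^sub>3)) (solutions (l\<^sub>1, l\<^sub>2, l\<^sub>3, l\<^sub>4))"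
proof (rule inj_onI)
  fix u v
  assume solutions: "u \<in> solutions (l\<^sub>1, l\<^sub>2, l\<^sub>3, l\<^sub>4)" "v \<in> solutions (l\<^sub>1, l\<^sub>2, l\<^sub>3, l\<^sub>4)"
    and scaled_eq: "(case u of (a, p\<^sub>1, p\<^sub>2, p\<^sub>3) \<Rightarrow> (a, (l\<^sub>1 - l\<^sub>4) * p\<^sub>1, (l\<^sub>3 - l\<^sub>4) * p\<^sub>3))
      = (case v of (a, p\<^sub>1, p\<^sub>2, p\<^sub>3) \<Rightarrow> (a, (l\<^sub>1 - l\<^sub>4) * p\<^sub>1, (l\<^sub>3 - l\<^sub>4) * p\<^sub>3))"
  obtain a p\<^sub>1 p\<^sub>2 p\<^sub>3 where u_eq: "u = (a, p\<^sub>1, p\<^sub>2, p\<^sub>3)" by (cases u)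
  obtain b q\<^sub>1 q\<^sub>2 q\<^sub>3 where v_eq: "v = (b, q\<^sub>1, q\<^sub>2, q\<^sub>3)" by (cases v)
  have components: "a = b" "p\<^sub>1 = q\<^sub>1" "p\<^sub>3 = q\<^sub>3" using scaled_eq assms by (simp_all add: u_eq v_eq)
  have "(l\<^sub>2 - l\<^sub>4) * p\<^sub>2 = (l\<^sub>3 - l\<^sub>4) * q\<^sub>3 - (l\<^sub>1 - l\<^sub>4) * q\<^sub>1"
    "(l\<^sub>2 - l\<^sub>4) * q\<^sub>2 = (l\<^sub>3 - l\<^sub>4) * q\<^sub>3 - (l\<^sub>1 - l\<^sub>4) * q\<^sub>1"
    using solutions by (simp_all add: u_eq v_eq solutions_def components eq_diff_eq add.commute)
  then have "(l\<^sub>2 - l\<^sub>4) * p\<^sub>2 = (l\<^sub>2 - l\<^sub>4) * q\<^sub>2" by (simp only:)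
  then show "u = v" using assms components by (simp add: u_eq v_eq)
qed

context regular_products
begin

definition dilates :: "real \<times> real \<times> real \<times> real \<Rightarrow> (real \<times> real) set" where
  "dilates = (\<lambda>(l\<^sub>1, l\<^sub>2, l\<^sub>3, l\<^sub>4).
     (\<lambda>(a, p\<^sub>1, p\<^sub>2, p\<^sub>3). (a * ((l\<^sub>1 - l\<^sub>4) * p\<^sub>1), a * ((l\<^sub>3 - l\<^sub>4) * p\<^sub>3))) ` solutions (l\<^sub>1, l\<^sub>2, l\<^sub>3, l\<^sub>4))"

lemma card_solutions_power6_le:
  assumes "\<theta> \<in> block_quadruples g"
  shows "real (card (solutions \<theta>)) ^ 6 \<le> 4210688 * real k * real (card A) ^ 5 * (2 * \<tau>) ^ 10 * card (dilates \<theta>)"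
proof -
  obtain l\<^sub>1 l\<^sub>2 l\<^sub>3 l\<^sub>4 where \<theta>_eq: "\<theta> = (l\<^sub>1, l\<^sub>2, l\<^sub>3, l\<^sub>4)" and in_S: "l\<^sub>1 \<in> S" "l\<^sub>2 \<in> S" "l\<^sub>3 \<in> S"
    and slopes: "l\<^sub>1 - l\<^sub>4 \<noteq> 0" "l\<^sub>2 - l\<^sub>4 \<noteq> 0" "l\<^sub>3 - l\<^sub>4 \<noteq> 0"
    using assms by (auto simp: block_quadruples_def)
  define part where "part l = (*) (l - l\<^sub>4) ` dilation_part A l" for l
  define W where "W = (\<lambda>(a, p\<^sub>1, p\<^sub>2, p\<^sub>3). (a, (l\<^sub>1 - l\<^sub>4) * p\<^sub>1, (l\<^sub>3 - l\<^sub>4) * p\<^sub>3)) ` solutions \<theta>"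
  have dilates: "dilates \<theta> = (\<lambda>(a, p, r). (a * p, a * r)) ` W"
    by (auto simp: dilates_def W_def \<theta>_eq image_image split_def)
  have finite_part: "finite (part l)" for l by (simp add: part_def finite_A)
  have card_part: "card (part l) \<le> 2 * \<tau>" if "l \<in> S" for l
  proof -
    have "card (part l) \<le> card (dilation_part A l)"
      unfolding part_def by (rule card_image_le) (simp add: finite_A)
    then show ?thesis using card_dilation_part[OF that] by linarith
  qed
  have zero_notin: "0 \<notin> dilation_part A l" "0 \<notin> A" for l
    using A_pos by (auto simp: dilation_part_def)
  have "card (solutions \<theta>) = card W"
    unfolding W_def \<theta>_eq by (rule card_image[OF inj_on_scaled_solutions, symmetric]) (use slopes in simp)
  moreover have "real (card W) ^ 6
      \<le> 4210688 * real k * real (card A) ^ 5 * (2 * \<tau>) ^ 10 * card ((\<lambda>(a, p, r). (a * p, a * r)) ` W)"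
  proof (rule card_dilates_ge[OF finite_A finite_part[of l\<^sub>1] finite_part[of l\<^sub>2] finite_part[of l\<^sub>3]])
    show "0 \<notin> A" "0 \<notin> part l\<^sub>1" "0 \<notin> part l\<^sub>3" using slopes zero_notin by (auto simp: part_def)
    show "W \<subseteq> A \<times> part l\<^sub>1 \<times> part l\<^sub>3"
      using G_subset in_S by (fastforce simp: W_def solutions_def \<theta>_eq part_def)
    show "r - p \<in> part l\<^sub>2" if "(a, p, r) \<in> W" for a p r
    proof -
      obtain p\<^sub>1 p\<^sub>2 p\<^sub>3 where "(a, p\<^sub>2) \<in> G l\<^sub>2" "p = (l\<^sub>1 - l\<^sub>4) * p\<^sub>1" "r = (l\<^sub>3 - l\<^sub>4) * p\<^sub>3"
        "(l\<^sub>1 - l\<^sub>4) * p\<^sub>1 + (l\<^sub>2 - l\<^sub>4) * p\<^sub>2 = (l\<^sub>3 - l\<^sub>4) * p\<^sub>3"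
        using \<open>(a, p, r) \<in> W\<close> by (auto simp: W_def solutions_def \<theta>_eq)
      then show ?thesis using G_subset[OF in_S(2)] by (auto simp: part_def intro!: image_eqI[of _ _ p\<^sub>2])
    qed
  qed (use card_part in_S \<tau>_ge_1 \<tau>_less in auto)
  ultimately show ?thesis by (simp only: dilates)
qed

lemma dilate_Q:
  assumes "m \<in> S" "y \<in> Q m"
  shows "m * y \<in> prodset A"
proof -
  obtain a p where ap: "y = a * p" "a \<in> A" "m * p \<in> A"
    using subsetD[OF Q_subset[OF assms(1)] assms(2)] by (auto simp: dilation_part_def)
  have "m * y = a * (m * p)" by (simp add: ap(1))
  then show ?thesis using prodsetI[OF ap(2,3)] by (simp only:)
qed

lemma finite_Q: "l \<in> S \<Longrightarrow> finite (Q l)"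
  by (rule finite_subset[OF Q_subset]) (use finite_A in auto)

lemma popular_dilates:
  assumes "\<theta> = (l\<^sub>1, l\<^sub>2, l\<^sub>3, l\<^sub>4)" "l\<^sub>2 \<in> S" "(y, z) \<in> dilates \<theta>"
  shows "card A * \<tau> * card S
    \<le> 4 * real k * r * card (prodset A) * card {m\<in>S. m * (z - y) \<in> (*) (l\<^sub>2 - l\<^sub>4) ` prodset A}"
proof -
  obtain a p\<^sub>1 p\<^sub>2 p\<^sub>3 where p\<^sub>2_in_G: "(a, p\<^sub>2) \<in> G l\<^sub>2" and y_eq: "y = a * ((l\<^sub>1 - l\<^sub>4) * p\<^sub>1)" and z_eq: "z = a * ((l\<^sub>3 - l\<^sub>4) * p\<^sub>3)"
    and equation: "(l\<^sub>1 - l\<^sub>4) * p\<^sub>1 + (l\<^sub>2 - l\<^sub>4) * p\<^sub>2 = (l\<^sub>3 - l\<^sub>4) * p\<^sub>3"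
    using assms(3) by (auto simp: assms(1) dilates_def solutions_def)
  have difference: "z - y = (l\<^sub>2 - l\<^sub>4) * (a * p\<^sub>2)" unfolding y_eq z_eq equation[symmetric] by (simp add: algebra_simps)
  have "m * (z - y) \<in> (*) (l\<^sub>2 - l\<^sub>4) ` prodset A" if "m \<in> S" "a * p\<^sub>2 \<in> Q m" for m
    using dilate_Q[OF that] by (auto simp: difference intro!: image_eqI[of _ _ "m * (a * p\<^sub>2)"])
  then have "card {m\<in>S. a * p\<^sub>2 \<in> Q m} \<le> card {m\<in>S. m * (z - y) \<in> (*) (l\<^sub>2 - l\<^sub>4) ` prodset A}"
    using finite_S by (intro card_mono) auto
  then have "4 * real k * r * card (prodset A) * card {m\<in>S. a * p\<^sub>2 \<in> Q m}
      \<le> 4 * real k * r * card (prodset A) * card {m\<in>S. m * (z - y) \<in> (*) (l\<^sub>2 - l\<^sub>4) ` prodset A}"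
    using r_pos by (intro mult_left_mono) auto
  with popular[OF assms(2) p\<^sub>2_in_G] show ?thesis by (rule order_trans)
qed

lemma r_large: "card A * \<tau> \<le> 4 * real k * r * card (prodset A)"
proof -
  have pos: "0 < card A * \<tau> * card S"
    using finite_A A_nonempty finite_S S_nonempty \<tau>_ge_1 by (simp add: card_gt_0_iff)
  have "\<exists>l\<in>S. G l \<noteq> {}"
  proof (rule ccontr)
    assume "\<not> (\<exists>l\<in>S. G l \<noteq> {})"
    then have "(\<Sum>l\<in>S. card (G l)) = 0" by simp
    then show False using G_dense pos by simp
  qed
  then obtain l a p where "l \<in> S" "(a, p) \<in> G l" by auto
  then have "card A * \<tau> * card S \<le> 4 * real k * r * card (prodset A) * card {m\<in>S. a * p \<in> Q m}"
    by (rule popular)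
  also have "\<dots> \<le> 4 * real k * r * card (prodset A) * card S"
    using finite_S r_pos by (intro mult_left_mono of_nat_mono card_mono) auto
  finally show ?thesis using finite_S S_nonempty by (simp add: card_gt_0_iff)
qed

lemma dilates_incidence_bound:
  fixes B \<rho> :: real
  assumes "\<theta> \<in> block_quadruples g"
  defines "B \<equiv> 2 * card A * \<tau> / r" and "\<rho> \<equiv> card S * B / (8 * real k * card (prodset A))"
  assumes large: "8 * real (card S) * B \<le> card (dilates \<theta>) * \<rho>"
  shows "(card (dilates \<theta>) * \<rho>) ^ 3 \<le> 1024 * (card (prodset A) * B * (card S * B))\<^sup>2"
proof -
  obtain l\<^sub>1 l\<^sub>2 l\<^sub>3 l\<^sub>4 where \<theta>_eq: "\<theta> = (l\<^sub>1, l\<^sub>2, l\<^sub>3, l\<^sub>4)" and in_S: "l\<^sub>1 \<in> S" "l\<^sub>2 \<in> S" "l\<^sub>3 \<in> S"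
    using assms(1) by (auto simp: block_quadruples_def)
  define Y Z H where "Y = (*) (l\<^sub>1 - l\<^sub>4) ` Q l\<^sub>1" and "Z = (*) (l\<^sub>3 - l\<^sub>4) ` Q l\<^sub>3"
    and "H = (*) (l\<^sub>2 - l\<^sub>4) ` prodset A"
  have fin: "finite Y" "finite Z" "finite H"
    using in_S finite_Q finite_A by (simp_all add: Y_def Z_def H_def)
  have card_le: "card ((*) c ` Q l) \<le> B" if "l \<in> S" for c l
  proof -
    have "card ((*) c ` Q l) \<le> card (Q l)" by (rule card_image_le[OF finite_Q[OF that]])
    moreover have "card (Q l) \<le> B" using card_Q[OF that] r_pos by (simp add: B_def field_simps)
    ultimately show ?thesis by linarith
  qed
  have YZ: "card Y \<le> B" "card Z \<le> B" using in_S card_le by (simp_all add: Y_def Z_def)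
  have card_H: "card H \<le> card (prodset A)"
    unfolding H_def by (rule card_image_le) (simp add: finite_A)
  have "(card (dilates \<theta>) * \<rho>) ^ 3 \<le> 1024 * (real (card H) * card Y * (real (card S) * card Z))\<^sup>2"
  proof (rule card_popular_differences_le[OF finite_S fin(3,1,2) zero_notin_S])
    have "a * (c * p) \<in> (*) c ` Q l" if "l \<in> S" "(a, p) \<in> G l" for a p c l
    proof (rule image_eqI)
      show "a * (c * p) = c * (a * p)" by simp
      show "a * p \<in> Q l" using subsetD[OF G_products[OF that(1)] imageI[OF that(2)]] by simp
    qed
    then show "dilates \<theta> \<subseteq> Y \<times> Z"
      using in_S by (auto simp: \<theta>_eq dilates_def solutions_def Y_def Z_def)
    show "\<rho> \<le> card {m\<in>S. m * (z - y) \<in> H}" if "(y, z) \<in> dilates \<theta>" for y z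
      using popular_dilates[OF \<theta>_eq in_S(2) that] r_pos k_pos card_prodset_pos[OF finite_A A_nonempty]
      by (simp add: \<rho>_def B_def H_def field_simps)
    have "8 * real (card S) * card Z \<le> 8 * real (card S) * B" using YZ by (intro mult_left_mono) auto
    then show "8 * real (card S) * card Z \<le> card (dilates \<theta>) * \<rho>" using large by (rule order_trans)
  qed
  also have "\<dots> \<le> 1024 * (card (prodset A) * B * (card S * B))\<^sup>2"
    using YZ card_H r_pos \<tau>_ge_1 by (intro mult_left_mono power_mono mult_mono) (auto simp: B_def)
  finally show ?thesis .
qed

end

lemma power3_le_of_incidence_bound:
  fixes T \<sigma> B h \<kappa> :: real
  assumes pos: "0 \<le> T" "0 < \<sigma>" "0 < B" "0 < h" "1 \<le> \<kappa>" and B_le: "B \<le> 8 * \<kappa> * h" and \<sigma>_le: "\<sigma> \<le> h ^ 3"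
    and incidences: "8 * \<sigma> * B \<le> T * (\<sigma> * B / (8 * \<kappa> * h)) \<Longrightarrow>
      (T * (\<sigma> * B / (8 * \<kappa> * h))) ^ 3 \<le> 1024 * (h * B * (\<sigma> * B))\<^sup>2"
  shows "T ^ 3 * \<sigma> \<le> 4194304 * \<kappa> ^ 4 * h ^ 6"
proof (cases "8 * \<sigma> * B \<le> T * (\<sigma> * B / (8 * \<kappa> * h))")
  case True
  have "(T * (\<sigma> * B / (8 * \<kappa> * h))) ^ 3 = (T ^ 3 * \<sigma>) * (\<sigma>\<^sup>2 * B ^ 3) / (512 * \<kappa> ^ 3 * h ^ 3)"
    by (simp add: power_divide power_mult_distrib power_numeral_reduce mult_ac)
  with incidences[OF True]
  have "(T ^ 3 * \<sigma>) * (\<sigma>\<^sup>2 * B ^ 3) \<le> 1024 * (h * B * (\<sigma> * B))\<^sup>2 * (512 * \<kappa> ^ 3 * h ^ 3)"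
    using pos by (simp add: pos_divide_le_eq)
  also have "\<dots> = (524288 * \<kappa> ^ 3 * h ^ 5 * B) * (\<sigma>\<^sup>2 * B ^ 3)"
    by (simp add: power_mult_distrib power_numeral_reduce mult_ac)
  finally have "T ^ 3 * \<sigma> \<le> 524288 * \<kappa> ^ 3 * h ^ 5 * B"
    by (rule mult_right_le_imp_le) (use pos in auto)
  also have "\<dots> \<le> 524288 * \<kappa> ^ 3 * h ^ 5 * (8 * \<kappa> * h)"
    using B_le pos by (intro mult_left_mono) auto
  also have "\<dots> = 4194304 * \<kappa> ^ 4 * h ^ 6" by (simp add: power_numeral_reduce mult_ac)
  finally show ?thesis .
next
  case False
  then have "T * (\<sigma> * B) < 64 * \<kappa> * h * (\<sigma> * B)" using pos by (simp add: field_simps)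
  then have "T < 64 * \<kappa> * h" using pos by (simp add: mult_less_cancel_right)
  then have "T ^ 3 * \<sigma> \<le> (64 * \<kappa> * h) ^ 3 * h ^ 3"
    using \<sigma>_le pos by (intro mult_mono power_mono) auto
  also have "\<dots> = 262144 * \<kappa> ^ 3 * h ^ 6" by (simp add: power_mult_distrib power_numeral_reduce mult_ac)
  also have "\<dots> \<le> 4194304 * \<kappa> ^ 4 * h ^ 6"
    using pos by (intro mult_right_mono mult_mono power_increasing) auto
  finally show ?thesis .
qed

lemma (in regular_products) card_dilates_power3_le:
  assumes "\<theta> \<in> block_quadruples g"
  shows "real (card (dilates \<theta>)) ^ 3 * card S \<le> 4194304 * real k ^ 4 * real (card (prodset A)) ^ 6"
proof (rule power3_le_of_incidence_bound[OF _ _ _ _ _ _ _ dilates_incidence_bound[OF assms]])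
  have n_pos: "1 \<le> card A" using finite_A A_nonempty by (simp add: Suc_le_eq card_gt_0_iff)
  show "0 < 2 * card A * \<tau> / r" using n_pos \<tau>_ge_1 r_pos by simp
  show "2 * card A * \<tau> / r \<le> 8 * real k * card (prodset A)" using r_large r_pos by (simp add: field_simps)
  show "0 < real (card S)" using finite_S S_nonempty by (simp add: card_gt_0_iff)
  have "real (card S) * 1 \<le> card S * \<tau>" using \<tau>_ge_1 by (intro mult_left_mono) auto
  then have "real (card S) \<le> (real (card A))\<^sup>2" using card_S_mult_\<tau>_le by linarith
  also have "\<dots> \<le> real (card A) ^ 3" using n_pos by (intro power_increasing) auto
  also have "\<dots> \<le> real (card (prodset A)) ^ 3"
    using card_le_card_prodset[OF finite_A] A_pos by (intro power_mono of_nat_mono) auto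
  finally show "real (card S) \<le> real (card (prodset A)) ^ 3" .
qed (use card_prodset_pos[OF finite_A A_nonempty] k_pos in auto)

subsection \<open>The sum-product bound\<close>

locale sum_product_parameters =
  fixes n M \<sigma> \<tau> \<kappa> :: real
  assumes n_ge_1: "1 \<le> n" and n_le_M: "n \<le> M" and n_power4_le: "n ^ 4 \<le> M ^ 3"
    and \<sigma>_ge_1: "1 \<le> \<sigma>" and \<tau>_ge_1: "1 \<le> \<tau>" and \<kappa>_ge_1: "1 \<le> \<kappa>" and \<tau>_le: "\<tau> \<le> n"
    and \<sigma>\<tau>_le: "\<sigma> * \<tau> \<le> n\<^sup>2" and energy: "n ^ 4 \<le> 4 * \<kappa> * M * (\<sigma> * \<tau>\<^sup>2)"
begin

lemma M_ge_1: "1 \<le> M"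
  using n_ge_1 n_le_M by simp

lemma n_squared_le_\<sigma>: "n\<^sup>2 \<le> 4 * \<kappa> * M * \<sigma>"
proof -
  have "n ^ 4 \<le> 4 * \<kappa> * M * (\<sigma> * n\<^sup>2)"
    using energy
  proof (rule order_trans)
    show "4 * \<kappa> * M * (\<sigma> * \<tau>\<^sup>2) \<le> 4 * \<kappa> * M * (\<sigma> * n\<^sup>2)"
      using \<tau>_le \<tau>_ge_1 \<kappa>_ge_1 M_ge_1 \<sigma>_ge_1 by (intro mult_left_mono power_mono) auto
  qed
  then have "n\<^sup>2 * n\<^sup>2 \<le> (4 * \<kappa> * M * \<sigma>) * n\<^sup>2" by (simp add: power_numeral_reduce mult_ac)
  then show ?thesis by (rule mult_right_le_imp_le) (use n_ge_1 in simp)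
qed

lemma n_squared_le_\<tau>: "n\<^sup>2 \<le> 4 * \<kappa> * M * \<tau>"
proof -
  have "\<sigma> * \<tau>\<^sup>2 \<le> n\<^sup>2 * \<tau>"
    using mult_right_mono[OF \<sigma>\<tau>_le, of \<tau>] \<tau>_ge_1 by (simp add: power2_eq_square)
  then have "4 * \<kappa> * M * (\<sigma> * \<tau>\<^sup>2) \<le> 4 * \<kappa> * M * (n\<^sup>2 * \<tau>)"
    using \<kappa>_ge_1 M_ge_1 by (intro mult_left_mono) auto
  with energy have "n\<^sup>2 * n\<^sup>2 \<le> (4 * \<kappa> * M * \<tau>) * n\<^sup>2" by (simp add: power_numeral_reduce mult_ac)
  then show ?thesis by (rule mult_right_le_imp_le) (use n_ge_1 in simp)
qed

lemma block_length_le: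
  assumes "0 \<le> U" "U \<le> M" and g_le: "g \<le> 16 * \<kappa> + 64 * \<kappa>\<^sup>2 * U\<^sup>2 / (\<sigma> * \<tau>\<^sup>2) + 1"
  shows "n ^ 4 * g \<le> 273 * \<kappa> ^ 3 * M ^ 3"
proof -
  have \<sigma>\<tau>_pos: "0 < \<sigma> * \<tau>\<^sup>2" using \<sigma>_ge_1 \<tau>_ge_1 by simp
  have "(16 * \<kappa> + 1) * n ^ 4 \<le> 17 * \<kappa> ^ 3 * M ^ 3"
  proof (rule mult_mono[OF _ n_power4_le])
    have "\<kappa> \<le> \<kappa> ^ 3" using \<kappa>_ge_1 by (simp add: self_le_power)
    then show "16 * \<kappa> + 1 \<le> 17 * \<kappa> ^ 3" using \<kappa>_ge_1 by linarith
  qed (use n_ge_1 \<kappa>_ge_1 in auto)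
  moreover have "n ^ 4 * (64 * \<kappa>\<^sup>2 * U\<^sup>2 / (\<sigma> * \<tau>\<^sup>2)) \<le> 256 * \<kappa> ^ 3 * M ^ 3"
  proof -
    have "n ^ 4 * (64 * \<kappa>\<^sup>2 * U\<^sup>2) \<le> (4 * \<kappa> * M * (\<sigma> * \<tau>\<^sup>2)) * (64 * \<kappa>\<^sup>2 * M\<^sup>2)"
      using energy assms(1,2) \<kappa>_ge_1 M_ge_1 \<sigma>\<tau>_pos by (intro mult_mono mult_left_mono power_mono) auto
    also have "\<dots> = (256 * \<kappa> ^ 3 * M ^ 3) * (\<sigma> * \<tau>\<^sup>2)" by (simp add: power_numeral_reduce)
    finally show ?thesis using \<sigma>\<tau>_pos by (simp add: pos_divide_le_eq)
  qed
  moreover have "n ^ 4 * g \<le> n ^ 4 * (16 * \<kappa> + 64 * \<kappa>\<^sup>2 * U\<^sup>2 / (\<sigma> * \<tau>\<^sup>2) + 1)"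
    using g_le n_ge_1 by (intro mult_left_mono) auto
  then have "n ^ 4 * g \<le> (16 * \<kappa> + 1) * n ^ 4 + n ^ 4 * (64 * \<kappa>\<^sup>2 * U\<^sup>2 / (\<sigma> * \<tau>\<^sup>2))"
    by (simp add: algebra_simps)
  ultimately show ?thesis by linarith
qed

lemma power_bound_of_few_slopes:
  assumes "n ^ 4 * \<sigma> \<le> 273 * \<kappa> ^ 3 * M ^ 3"
  shows "n ^ 159 \<le> 1092 ^ 26 * \<kappa> ^ 156 * M ^ 119"
proof -
  have "n ^ 6 = n ^ 4 * n\<^sup>2" by (simp flip: power_add)
  also have "\<dots> \<le> n ^ 4 * (4 * \<kappa> * M * \<sigma>)"
    using n_ge_1 by (intro mult_left_mono n_squared_le_\<sigma>) auto
  also have "\<dots> = (4 * \<kappa> * M) * (n ^ 4 * \<sigma>)" by simp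
  also have "\<dots> \<le> (4 * \<kappa> * M) * (273 * \<kappa> ^ 3 * M ^ 3)"
    using assms \<kappa>_ge_1 M_ge_1 by (intro mult_left_mono) auto
  also have "\<dots> = 1092 * \<kappa> ^ 4 * M ^ 4" by (simp add: power_numeral_reduce)
  finally have power6: "n ^ 6 \<le> 1092 * \<kappa> ^ 4 * M ^ 4" .
  have "n ^ 159 = (n ^ 6) ^ 26 * n ^ 3" by (simp flip: power_mult power_add)
  also have "\<dots> \<le> (1092 * \<kappa> ^ 4 * M ^ 4) ^ 26 * M ^ 3"
    using power6 n_le_M n_ge_1 \<kappa>_ge_1 M_ge_1 by (intro mult_mono power_mono) auto
  also have "\<dots> = 1092 ^ 26 * \<kappa> ^ 104 * M ^ 107"
    unfolding power_mult_distrib power_mult[symmetric] by (simp add: mult.assoc power_add[symmetric])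
  also have "\<dots> \<le> 1092 ^ 26 * \<kappa> ^ 156 * M ^ 119"
    using \<kappa>_ge_1 M_ge_1 by (intro mult_mono power_increasing) auto
  finally show ?thesis .
qed

lemma solution_count_ge:
  assumes w_bounds: "0 \<le> w" "n * \<tau>\<^sup>2 \<le> 16 * \<kappa>\<^sup>2 * g\<^sup>2 * w" and g_bounds: "0 \<le> g" "n ^ 4 * g \<le> 273 * \<kappa> ^ 3 * M ^ 3"
  shows "n ^ 9 * \<tau>\<^sup>2 \<le> (16 * 273\<^sup>2) * \<kappa> ^ 8 * M ^ 6 * w"
proof -
  have "n ^ 9 * \<tau>\<^sup>2 = (n ^ 4)\<^sup>2 * (n * \<tau>\<^sup>2)" by (simp add: power_numeral_reduce)
  also have "\<dots> \<le> (n ^ 4)\<^sup>2 * (16 * \<kappa>\<^sup>2 * g\<^sup>2 * w)" using w_bounds by (intro mult_left_mono) auto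
  also have "\<dots> = 16 * \<kappa>\<^sup>2 * (n ^ 4 * g)\<^sup>2 * w" by (simp add: power_mult_distrib)
  also have "\<dots> \<le> 16 * \<kappa>\<^sup>2 * (273 * \<kappa> ^ 3 * M ^ 3)\<^sup>2 * w"
    using g_bounds n_ge_1 w_bounds(1) by (intro mult_right_mono mult_left_mono power_mono) auto
  also have "\<dots> = (16 * 273\<^sup>2) * \<kappa> ^ 8 * M ^ 6 * w" by (simp add: power_mult_distrib power_numeral_reduce)
  finally show ?thesis .
qed

lemma power_bound_of_rich_solutions:
  assumes w_ge: "n * \<tau>\<^sup>2 \<le> 16 * \<kappa>\<^sup>2 * g\<^sup>2 * w" and g_bounds: "0 \<le> g" "n ^ 4 * g \<le> 273 * \<kappa> ^ 3 * M ^ 3"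
    and solutions: "0 \<le> w" "w ^ 6 \<le> c * \<kappa> * n ^ 5 * (2 * \<tau>) ^ 10 * x" "x ^ 3 * \<sigma> \<le> d * \<kappa> ^ 4 * M ^ 6"
    and c_nonneg: "0 \<le> c"
  shows "n ^ 159 \<le> (16 * 273\<^sup>2) ^ 18 * c ^ 3 * 2 ^ 30 * d * 4 ^ 5 * \<kappa> ^ 156 * M ^ 119"
proof -
  define e :: real where "e = 16 * 273\<^sup>2"
  have e_nonneg: "0 \<le> e" by (simp add: e_def)
  have count: "n ^ 9 * \<tau>\<^sup>2 \<le> e * \<kappa> ^ 8 * M ^ 6 * w"
    unfolding e_def by (rule solution_count_ge[OF solutions(1) w_ge g_bounds])
  have "(n ^ 147 * (\<sigma> * \<tau> ^ 6)) * (n ^ 15 * \<tau> ^ 30) = (n ^ 147 * n ^ 15) * (\<tau> ^ 6 * \<tau> ^ 30) * \<sigma>"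
    by (simp only: mult_ac)
  also have "\<dots> = (n ^ 9 * \<tau>\<^sup>2) ^ 18 * \<sigma>"
    by (simp add: power_mult_distrib flip: power_mult)
  also have "\<dots> \<le> (e * \<kappa> ^ 8 * M ^ 6 * w) ^ 18 * \<sigma>"
    using count n_ge_1 \<sigma>_ge_1 by (intro mult_right_mono power_mono) auto
  also have "\<dots> = (e * \<kappa> ^ 8 * M ^ 6) ^ 18 * (w ^ 6) ^ 3 * \<sigma>"
    by (simp add: power_mult_distrib flip: power_mult)
  also have "\<dots> \<le> (e * \<kappa> ^ 8 * M ^ 6) ^ 18 * (c * \<kappa> * n ^ 5 * (2 * \<tau>) ^ 10 * x) ^ 3 * \<sigma>"
    using solutions(1,2) \<sigma>_ge_1 \<kappa>_ge_1 M_ge_1 e_nonneg by (intro mult_right_mono mult_left_mono power_mono) auto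
  also have "\<dots> = (e ^ 18 * c ^ 3 * 2 ^ 30 * \<kappa> ^ 147 * M ^ 108 * (n ^ 15 * \<tau> ^ 30)) * (x ^ 3 * \<sigma>)"
    by (simp add: power_mult_distrib mult_ac flip: power_mult power_add)
  also have "\<dots> \<le> (e ^ 18 * c ^ 3 * 2 ^ 30 * \<kappa> ^ 147 * M ^ 108 * (n ^ 15 * \<tau> ^ 30)) * (d * \<kappa> ^ 4 * M ^ 6)"
    using solutions(3) c_nonneg e_nonneg \<kappa>_ge_1 M_ge_1 n_ge_1 \<tau>_ge_1 by (intro mult_left_mono) auto
  also have "\<dots> = (e ^ 18 * c ^ 3 * 2 ^ 30 * d * \<kappa> ^ 151 * M ^ 114) * (n ^ 15 * \<tau> ^ 30)"
    by (simp add: mult_ac flip: power_add)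
  finally have cancelled: "n ^ 147 * (\<sigma> * \<tau> ^ 6) \<le> e ^ 18 * c ^ 3 * 2 ^ 30 * d * \<kappa> ^ 151 * M ^ 114"
    by (rule mult_right_le_imp_le) (use n_ge_1 \<tau>_ge_1 in simp)
  have "n ^ 159 = n ^ 147 * (n ^ 4 * (n\<^sup>2) ^ 4)" by (simp flip: power_mult power_add)
  also have "\<dots> \<le> n ^ 147 * ((4 * \<kappa> * M * (\<sigma> * \<tau>\<^sup>2)) * (4 * \<kappa> * M * \<tau>) ^ 4)"
    using n_ge_1 \<kappa>_ge_1 M_ge_1 \<sigma>_ge_1 by (intro mult_left_mono mult_mono power_mono energy n_squared_le_\<tau>) auto
  also have "\<dots> = (n ^ 147 * (\<sigma> * \<tau> ^ 6)) * (4 * \<kappa> * M) ^ 5"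
    by (simp add: power_mult_distrib power_numeral_reduce mult_ac)
  also have "\<dots> \<le> (e ^ 18 * c ^ 3 * 2 ^ 30 * d * \<kappa> ^ 151 * M ^ 114) * (4 * \<kappa> * M) ^ 5"
    using cancelled \<kappa>_ge_1 M_ge_1 by (intro mult_right_mono) auto
  also have "\<dots> = e ^ 18 * c ^ 3 * 2 ^ 30 * d * 4 ^ 5 * \<kappa> ^ 156 * M ^ 119"
    by (simp add: power_mult_distrib mult_ac flip: power_add)
  finally show ?thesis by (simp only: e_def)
qed

end

definition sum_product_const :: real where
  "sum_product_const = max (1092 ^ 26) ((16 * 273\<^sup>2) ^ 18 * 4210688 ^ 3 * 2 ^ 30 * 4194304 * 4 ^ 5)"

lemma (in popular_slopes) sum_product_parameters:
  fixes M :: real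
  assumes "0 < k" and M_bounds: "card (prodset A) \<le> M" "real (card A) ^ 4 \<le> M ^ 3"
    and energy: "real (card A) ^ 4 \<le> 4 * real k * card (prodset A) * (card S * \<tau>\<^sup>2)"
  shows "sum_product_parameters (card A) M (card S) \<tau> k"
proof
  show "1 \<le> real (card A)" "1 \<le> real (card S)"
    using finite_A A_nonempty finite_S S_nonempty by (simp_all add: Suc_le_eq card_gt_0_iff)
  have "card A \<le> card (prodset A)" using A_pos by (intro card_le_card_prodset finite_A) auto
  then show "card A \<le> M" using M_bounds(1) by linarith
  show "real (card A) ^ 4 \<le> 4 * real k * M * (card S * \<tau>\<^sup>2)"
    using energy
  proof (rule order_trans)
    show "4 * real k * card (prodset A) * (card S * \<tau>\<^sup>2) \<le> 4 * real k * M * (card S * \<tau>\<^sup>2)"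
      using M_bounds(1) by (intro mult_right_mono mult_left_mono) auto
  qed
qed (use M_bounds(2) assms(1) \<tau>_ge_1 \<tau>_le_card_A card_S_mult_\<tau>_le in auto)

lemma (in regular_products) power_bound_of_long_blocks:
  fixes M :: real
  assumes "sum_product_parameters (card A) M (card S) \<tau> k" and M_ge: "card (prodset A) \<le> M"
    and g_bounds: "g \<le> card S" "16 * real k \<le> g" "real (card A) ^ 4 * g \<le> 273 * real k ^ 3 * M ^ 3"
      "64 * (real k)\<^sup>2 * (real (card (sumset A)))\<^sup>2 \<le> card S * \<tau>\<^sup>2 * g"
  shows "real (card A) ^ 159
    \<le> (16 * 273\<^sup>2) ^ 18 * 4210688 ^ 3 * 2 ^ 30 * 4194304 * 4 ^ 5 * real k ^ 156 * M ^ 119"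
proof -
  interpret parameters: sum_product_parameters "card A" M "card S" \<tau> k by fact
  have pos: "0 < \<tau>" "1 \<le> 2 * real k" using \<tau>_ge_1 k_pos by simp_all
  have fibre: "card (dilation_part A l) \<le> 2 * \<tau>" if "l \<in> S" for l
    using card_dilation_part[OF that] by simp
  have dense: "card A * \<tau> * card S \<le> 2 * real k * card points"
    using G_dense by (simp add: card_points)
  have g_large: "8 * (2 * real k) \<le> g"
    and sumset_small: "16 * (2 * real k)\<^sup>2 * (real (card (sumset A)))\<^sup>2 \<le> card S * \<tau>\<^sup>2 * g"
    using g_bounds(2,4) by (simp_all add: power_mult_distrib)
  obtain \<theta> where quadruple: "\<theta> \<in> block_quadruples g"
    and rich: "card A * \<tau>\<^sup>2 \<le> 4 * (2 * real k)\<^sup>2 * (real g)\<^sup>2 * card (solutions \<theta>)"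
    by (rule exists_rich_block_quadruple[OF A_nonempty pos fibre dense g_large g_bounds(1) sumset_small])
  show ?thesis
  proof (rule parameters.power_bound_of_rich_solutions[OF _ _ g_bounds(3) _ card_solutions_power6_le[OF quadruple]])
    show "card A * \<tau>\<^sup>2 \<le> 16 * (real k)\<^sup>2 * (real g)\<^sup>2 * card (solutions \<theta>)"
      using rich by (simp add: power_mult_distrib)
    have "4194304 * real k ^ 4 * real (card (prodset A)) ^ 6 \<le> 4194304 * real k ^ 4 * M ^ 6"
      using M_ge by (intro mult_left_mono power_mono) auto
    with card_dilates_power3_le[OF quadruple]
    show "real (card (dilates \<theta>)) ^ 3 * card S \<le> 4194304 * real k ^ 4 * M ^ 6" by linarith
  qed auto
qed

lemma (in popular_slopes) card_power159_le:
  fixes M :: real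
  assumes card_less: "2 * card A < 2 ^ k"
    and M_bounds: "card (sumset A) \<le> M" "card (prodset A) \<le> M" "real (card A) ^ 4 \<le> M ^ 3"
    and energy: "real (card A) ^ 4 \<le> 4 * real k * card (prodset A) * (card S * \<tau>\<^sup>2)"
  shows "real (card A) ^ 159 \<le> sum_product_const * real k ^ 156 * M ^ 119"
proof -
  have k_pos: "0 < k" using card_less A_nonempty finite_A by (cases k) (auto simp: card_gt_0_iff)
  have params: "sum_product_parameters (card A) M (card S) \<tau> k"
    by (rule sum_product_parameters[OF k_pos M_bounds(2,3) energy])
  then interpret parameters: sum_product_parameters "card A" M "card S" \<tau> k .
  have pos: "0 < card S * \<tau>\<^sup>2" using parameters.\<sigma>_ge_1 \<tau>_ge_1 by simp
  define ratio where "ratio = 64 * (real k)\<^sup>2 * (real (card (sumset A)))\<^sup>2 / (card S * \<tau>\<^sup>2)"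
  define g where "g = nat \<lceil>16 * real k + ratio\<rceil>"
  have "0 \<le> ratio" using pos by (simp add: ratio_def)
  then have g_bounds: "ratio \<le> g" "16 * real k \<le> g" "g \<le> 16 * real k + ratio + 1"
    unfolding g_def by linarith+
  have g_le: "real (card A) ^ 4 * g \<le> 273 * real k ^ 3 * M ^ 3"
    by (rule parameters.block_length_le[OF _ M_bounds(1) g_bounds(3)[unfolded ratio_def]]) simp
  have enlarge_const: ?thesis if "real (card A) ^ 159 \<le> c * real k ^ 156 * M ^ 119" "c \<le> sum_product_const" for c
    using that(1)
  proof (rule order_trans)
    show "c * real k ^ 156 * M ^ 119 \<le> sum_product_const * real k ^ 156 * M ^ 119"
      using that(2) parameters.M_ge_1 by (intro mult_right_mono) auto
  qed
  show ?thesis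
  proof (cases "g \<le> card S")
    case False
    then have "real (card A) ^ 4 * card S \<le> real (card A) ^ 4 * g" by (intro mult_left_mono) auto
    with g_le have "real (card A) ^ 4 * card S \<le> 273 * real k ^ 3 * M ^ 3" by linarith
    then show ?thesis
      by (intro enlarge_const[OF parameters.power_bound_of_few_slopes]) (simp_all add: sum_product_const_def)
  next
    case True
    have "real (2 * card A) < real (2 ^ k)" using card_less by (simp only: of_nat_less_iff)
    then have "2 * \<tau> < 2 ^ k" using \<tau>_le_card_A by simp
    then obtain G Q r where "regular_products A S \<tau> G Q r k"
      using exists_regular_products[OF k_pos] by blast
    then interpret regular_products A S \<tau> G Q r k .
    have "64 * (real k)\<^sup>2 * (real (card (sumset A)))\<^sup>2 \<le> card S * \<tau>\<^sup>2 * g"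
      using g_bounds(1) pos by (simp add: ratio_def pos_divide_le_eq mult.commute)
    then show ?thesis
      by (intro enlarge_const[OF power_bound_of_long_blocks[OF params M_bounds(2) True g_bounds(2) g_le]])
         (simp_all add: sum_product_const_def)
  qed
qed

lemma sum_product_power_bound:
  fixes A :: "real set" and M :: real
  assumes "finite A" "A \<noteq> {}" "\<And>a. a \<in> A \<Longrightarrow> 0 < a" "2 * card A < 2 ^ k"
    and "card (sumset A) \<le> M" "card (prodset A) \<le> M" "real (card A) ^ 4 \<le> M ^ 3"
  shows "real (card A) ^ 159 \<le> sum_product_const * real k ^ 156 * M ^ 119"
proof -
  have "card A < 2 ^ k" using assms(4) by linarith
  with assms(1-3) obtain S and \<tau> :: real where "popular_slopes A S \<tau>"
    and energy: "real (card A) ^ 4 \<le> 4 * real k * card (prodset A) * (card S * \<tau>\<^sup>2)"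
    by (rule exists_popular_slopes)
  then interpret popular_slopes A S \<tau> by simp
  show ?thesis using assms(4-7) energy by (rule card_power159_le)
qed

lemma eventually_log_power_mult_powr_less:
  fixes a b c C :: real
  assumes "a < b"
  shows "eventually (\<lambda>x. C * (log 2 x + c) ^ m * x powr a < x powr b) at_top"
proof -
  define \<delta> where "\<delta> = b - a"
  have "0 < \<delta>" using assms by (simp add: \<delta>_def)
  then have "((\<lambda>x. C * (log 2 x + c) ^ m * x powr - \<delta>) \<longlongrightarrow> 0) at_top"
    by real_asymp
  then have "eventually (\<lambda>x. C * (log 2 x + c) ^ m * x powr - \<delta> < 1) at_top"
    by (rule order_tendstoD) simp
  then show ?thesis
    using eventually_gt_at_top[of 0]
  proof eventually_elim
    case (elim x)
    then have "C * (log 2 x + c) ^ m * x powr - \<delta> * x powr b < 1 * x powr b"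
      by (intro mult_strict_right_mono) auto
    then show ?case by (simp add: mult.assoc \<delta>_def flip: powr_add)
  qed
qed

lemma exists_dyadic_exponent:
  assumes "0 < n"
  obtains k where "2 * n < 2 ^ k" "real k \<le> log 2 (real n) + 2"
proof
  show "2 * n < 2 ^ (floor_log n + 2)" using floor_log_exp2_gt[of n] by simp
  show "real (floor_log n + 2) \<le> log 2 (real n) + 2"
    using le_log2_of_power[OF floor_log_exp2_le[OF assms]] by simp
qed

lemma sum_product_positive:
  fixes \<theta> :: real
  assumes \<theta>_bounds: "4/3 \<le> \<theta>" "\<theta> < 159/119"
  obtains N :: nat where "0 < N" "\<And>A. finite A \<Longrightarrow> (\<And>a. a \<in> A \<Longrightarrow> 0 < a) \<Longrightarrow> N \<le> card A \<Longrightarrow>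
    card A powr \<theta> \<le> max (card (sumset A)) (card (prodset A))"
proof -
  have "119 * \<theta> < 159" using \<theta>_bounds(2) by simp
  have "eventually (\<lambda>x. sum_product_const * (log 2 x + 2) ^ 156 * x powr (119 * \<theta>) < x powr 159) at_top"
    using \<open>119 * \<theta> < 159\<close> by (rule eventually_log_power_mult_powr_less)
  then obtain x\<^sub>0 where beyond_x\<^sub>0: "\<And>x. x\<^sub>0 \<le> x \<Longrightarrow>
      sum_product_const * (log 2 x + 2) ^ 156 * x powr (119 * \<theta>) < x powr 159"
    by (auto simp: eventually_at_top_linorder)
  define N where "N = max 1 (nat \<lceil>x\<^sub>0\<rceil>)"
  have "card A powr \<theta> \<le> max (card (sumset A)) (card (prodset A))"
    if A_large: "finite A" "\<And>a. a \<in> A \<Longrightarrow> 0 < a" "N \<le> card A" for A :: "real set"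
  proof (rule ccontr)
    define n where "n = real (card A)"
    assume "\<not> card A powr \<theta> \<le> max (card (sumset A)) (card (prodset A))"
    then have sums_small: "card (sumset A) \<le> n powr \<theta>" "card (prodset A) \<le> n powr \<theta>" by (auto simp: n_def)
    have n_ge: "1 \<le> n" "x\<^sub>0 \<le> n" using A_large(3) by (auto simp: N_def n_def)
    have "0 < card A" using n_ge(1) by (simp add: n_def)
    then obtain k where dyadic: "2 * card A < 2 ^ k" "real k \<le> log 2 n + 2"
      unfolding n_def by (rule exists_dyadic_exponent)
    have "n ^ 4 \<le> (n powr \<theta>) ^ 3"
    proof -
      have "n ^ 4 = n powr 4" using n_ge by simp
      also have "\<dots> \<le> n powr (3 * \<theta>)" using \<theta>_bounds(1) n_ge by (intro powr_mono) auto
      finally show ?thesis using n_ge by (simp add: powr_power mult.commute)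
    qed
    moreover have "A \<noteq> {}" using \<open>0 < card A\<close> by auto
    ultimately have "n ^ 159 \<le> sum_product_const * real k ^ 156 * (n powr \<theta>) ^ 119"
      unfolding n_def using A_large(1,2) dyadic(1) sums_small by (intro sum_product_power_bound) (simp_all add: n_def)
    also have "(n powr \<theta>) ^ 119 = n powr (119 * \<theta>)" using n_ge by (simp add: powr_power mult.commute)
    also have "sum_product_const * real k ^ 156 * n powr (119 * \<theta>)
        \<le> sum_product_const * (log 2 n + 2) ^ 156 * n powr (119 * \<theta>)"
      using dyadic(2) by (intro mult_right_mono mult_left_mono power_mono) (auto simp: sum_product_const_def)
    also have "\<dots> < n powr 159" by (rule beyond_x\<^sub>0[OF n_ge(2)])
    finally show False using n_ge by simp
  qed
  moreover have "0 < N" by (simp add: N_def)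
  ultimately show thesis using that by blast
qed

lemma sumset_mono: "B \<subseteq> A \<Longrightarrow> sumset B \<subseteq> sumset A"
  by (auto simp: sumset_def)

lemma prodset_mono: "B \<subseteq> A \<Longrightarrow> prodset B \<subseteq> prodset A"
  by (auto simp: prodset_def)

lemma sumset_uminus: "sumset (uminus ` A) = uminus ` sumset A"
  by (force simp: sumset_def image_iff)

lemma prodset_uminus: "prodset (uminus ` A) = prodset A"
proof -
  have "prodset (uminus ` B) \<subseteq> prodset B" for B
    by (auto simp: prodset_def[of "uminus ` B"] intro: prodsetI)
  from this[of A] this[of "uminus ` A"] show ?thesis by (simp add: image_image)
qed

lemma exists_positive_subset:
  fixes A :: "real set"
  assumes "finite A" "2 \<le> card A"
  obtains B where "finite B" "\<And>b. b \<in> B \<Longrightarrow> 0 < b" "card A \<le> 4 * card B"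
    "card (sumset B) \<le> card (sumset A)" "card (prodset B) \<le> card (prodset A)"
proof -
  define P Q where "P = {a\<in>A. 0 < a}" and "Q = {a\<in>A. a < 0}"
  have "card A \<le> card (P \<union> (Q \<union> {0}))"
    by (rule card_mono) (use assms(1) in \<open>auto simp: P_def Q_def\<close>)
  also have "\<dots> \<le> card P + (card Q + card {0 :: real})"
    by (intro order_trans[OF card_Un_le] add_left_mono card_Un_le)
  finally have "card A \<le> 4 * card P \<or> card A \<le> 4 * card Q" using assms(2) by auto
  have card_mono_sets: "card (sumset B) \<le> card (sumset A)" "card (prodset B) \<le> card (prodset A)" if "B \<subseteq> A" for B
    using that assms(1) by (auto intro!: card_mono sumset_mono prodset_mono)
  have subsets: "P \<subseteq> A" "Q \<subseteq> A" by (auto simp: P_def Q_def)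
  from \<open>_ \<or> _\<close> show thesis
  proof
    assume P_large: "card A \<le> 4 * card P"
    show thesis
      by (rule that[OF _ _ P_large card_mono_sets[OF subsets(1)]]) (use assms(1) in \<open>auto simp: P_def\<close>)
  next
    assume Q_large: "card A \<le> 4 * card Q"
    have "card A \<le> 4 * card (uminus ` Q)" using Q_large by (simp add: card_image)
    moreover have "card (sumset (uminus ` Q)) \<le> card (sumset A)"
      using card_mono_sets(1)[OF subsets(2)] by (simp add: sumset_uminus card_image)
    moreover have "card (prodset (uminus ` Q)) \<le> card (prodset A)"
      using card_mono_sets(2)[OF subsets(2)] by (simp add: prodset_uminus)
    ultimately show thesis
      by (rule that[rotated 2]) (use assms(1) in \<open>auto simp: Q_def\<close>)
  qed
qed

lemma powr_le_of_positive_sets: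
  fixes A :: "real set" and \<theta> :: real and N :: nat
  assumes "0 < N" "0 \<le> \<theta>" and finA: "finite A"
    and positive: "\<And>B. finite B \<Longrightarrow> (\<And>b. b \<in> B \<Longrightarrow> 0 < b) \<Longrightarrow> N \<le> card B \<Longrightarrow>
      card B powr \<theta> \<le> max (card (sumset B)) (card (prodset B))"
  shows "(card A / (4 * N)) powr \<theta> \<le> max (card (sumset A)) (card (prodset A))"
proof -
  consider (large) "4 * N \<le> card A" | (small) "A \<noteq> {}" "card A < 4 * N" | (empty) "A = {}" by linarith
  then show ?thesis
  proof cases
    case large
    with assms(1) have "2 \<le> card A" by linarith
    with finA obtain B where B_pos: "finite B" "\<And>b. b \<in> B \<Longrightarrow> 0 < b" and card_B: "card A \<le> 4 * card B"
      and sums_le: "card (sumset B) \<le> card (sumset A)" "card (prodset B) \<le> card (prodset A)"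
      by (rule exists_positive_subset) blast
    have "card A / (4 * N) \<le> card A / 4" using assms(1) by (intro divide_left_mono) auto
    also have "\<dots> \<le> card B" using card_B by linarith
    finally have "(card A / (4 * N)) powr \<theta> \<le> card B powr \<theta>" using assms(2) by (intro powr_mono2) auto
    also have "\<dots> \<le> max (card (sumset B)) (card (prodset B))"
      using B_pos large card_B by (intro positive) auto
    also have "\<dots> \<le> max (card (sumset A)) (card (prodset A))" using sums_le by (intro of_nat_mono max.mono)
    finally show ?thesis .
  next
    case small
    then have "(card A / (4 * N)) powr \<theta> \<le> 1" using assms(2) by (intro powr_le1) auto
    also have "\<dots> \<le> max (card (sumset A)) (card (prodset A))"
      using card_prodset_pos[OF finA small(1)] by (simp add: le_max_iff_disj Suc_le_eq)
    finally show ?thesis .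
  qed simp
qed

lemma sum_product:
  fixes \<theta> :: real
  assumes "4/3 \<le> \<theta>" "\<theta> < 159/119"
  shows "\<exists>c>0. \<forall>A. finite A \<longrightarrow> c * card A powr \<theta> \<le> max (card (sumset A)) (card (prodset A))"
proof -
  obtain N :: nat where N_pos: "0 < N" and positive: "\<And>B. finite B \<Longrightarrow> (\<And>b. b \<in> B \<Longrightarrow> 0 < b) \<Longrightarrow> N \<le> card B \<Longrightarrow>
      card B powr \<theta> \<le> max (card (sumset B)) (card (prodset B))"
    using sum_product_positive[OF assms] by blast
  have "(1 / (4 * N)) powr \<theta> * card A powr \<theta> \<le> max (card (sumset A)) (card (prodset A))"
    if "finite A" for A :: "real set"
    using powr_le_of_positive_sets[OF N_pos _ that positive] assms(1) by (simp flip: powr_mult)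
  moreover have "0 < (1 / (4 * N)) powr \<theta>" using N_pos by simp
  ultimately show ?thesis by blast
qed

theorem theorem1p2:
  fixes \<epsilon> :: real
  assumes "\<epsilon> > 0"
  shows "\<exists>c > (0::real). \<forall>A :: real set. finite A \<longrightarrow>
           real (max (card (sumset A)) (card (prodset A)))
             \<ge> c * real (card A) powr (4/3 + 10/4407 - \<epsilon>)"
proof -
  obtain c where c_pos: "0 < c" and bound: "\<And>A. finite A \<Longrightarrow>
      c * card A powr (4/3 + 10/4407) \<le> max (card (sumset A)) (card (prodset A))"
    using sum_product[of "4/3 + 10/4407"] by auto
  have "c * card A powr (4/3 + 10/4407 - \<epsilon>) \<le> c * card A powr (4/3 + 10/4407)" for A :: "real set"
    using assms c_pos by (cases "card A = 0") (auto intro!: mult_left_mono powr_mono)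
  then show ?thesis using c_pos bound by (blast intro: order_trans)
qed

end
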